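(* Assume that $F:\mathbb{R}^n\rightrightarrows\mathbb{R}^n$ (with graph locally closed around $(\bar x,\bar y)$) is graphically Lipschitzian of dimension $n$ at $(\bar x,\bar y)\in\mathrm{gph}\,F$ with transformation mapping $\Phi$, and let $f$ be the corresponding Lipschitz continuous mapping. Then $F$ has the SCD property around $(\bar x,\bar y)$ and for every $(x,y)\in\mathrm{gph}\,F$ sufficiently close to $(\bar x,\bar y)$ one has, with $u:=\pi_1(\Phi(x,y))$, $$\mathcal{S}F(x,y)=\nabla\Phi(x,y)^{-1}\mathcal{S}f(u)=\Big\{\mathrm{rge}\Big[\nabla\Phi(x,y)^{-1}\begin{pmatrix} I \\ B \end{pmatrix}\Big]\ \Big|\ B\in\overline{\nabla}f(u)\Big\},$$ $$\mathcal{S}^*F(x,y)=S_n\nabla\Phi(x,y)^TS_n^T\,\mathcal{S}^*f(u)=\Big\{\mathrm{rge}\Big[S_n\nabla\Phi(x,y)^TS_n^T\begin{pmatrix} I \\ B^T \end{pmatrix}\Big]\ \Big|\ B\in\overline{\nabla}f(u)\Big\}.$$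
   Context: Norms are Euclidean (operator norm for matrices). $\mathrm{gph}\,F=\{(x,y)\mid y\in F(x)\}$. For a set $A$ and $\bar z\in A$, the tangent cone $T_A(\bar z)$ is the set of all $w$ for which there are $t_k\downarrow0$, $w_k\to w$ with $\bar z+t_kw_k\in A$ for all $k$. $\mathcal{Z}_n$ is the set of $n$-dimensional linear subspaces of $\mathbb{R}^{2n}=\mathbb{R}^n\times\mathbb{R}^n$ with metric $d_{\mathcal{Z}}(L_1,L_2)=\|P_1-P_2\|$, $P_i$ the orthogonal projection onto $L_i$. $L^*:=\{(-v^*,u^* )\mid(u^*,v^* )\in L^\perp\}$. $S_n:=\begin{pmatrix} 0 & -I \\ I & 0 \end{pmatrix}$ ($2n\times2n$). $\pi_1(z)$ denotes the first $n$ components of $z\in\mathbb{R}^{2n}$; $\mathrm{rge}$ is the range of a matrix; for a $2n\times2n$ matrix $M$ and a collection $\mathcal{C}$ of subspaces, $M\mathcal{C}=\{ML\mid L\in\mathcal{C}\}$. $\mathcal{O}_F$ is the set of $(x,y)\in\mathrm{gph}\,F$ with $T_{\mathrm{gph}\,F}(x,y)\in\mathcal{Z}_n$. For $(x,y)\in\mathrm{gph}\,F$, $\mathcal{S}F(x,y)$ (resp. $\mathcal{S}^*F(x,y)$) is the set of all $L\in\mathcal{Z}_n$ for which there is a sequence $(x_k,y_k)\to(x,y)$ in $\mathcal{O}_F$ with $d_{\mathcal{Z}}(L,T_{\mathrm{gph}\,F}(x_k,y_k))\to0$ (resp. $d_{\mathcal{Z}}(L,T_{\mathrm{gph}\,F}(x_k,y_k)^*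 )\to0$). For a single-valued $f$ one writes $\mathcal{S}f(u):=\mathcal{S}f(u,f(u))$, $\mathcal{S}^*f(u):=\mathcal{S}^*f(u,f(u))$. $F$ has the SCD property around $(\bar x,\bar y)$ if $\mathcal{S}^*F(x,y)\neq\emptyset$ for all $(x,y)\in\mathrm{gph}\,F$ in some neighborhood of $(\bar x,\bar y)$. $F$ is graphically Lipschitzian of dimension $n$ at $(\bar x,\bar y)$ with transformation mapping $\Phi$ if there is an open neighborhood $W$ of $(\bar x,\bar y)$ such that $\Phi$ is a one-to-one mapping from $W$ onto an open subset of $\mathbb{R}^{2n}$, $\Phi$ and $\Phi^{-1}$ are continuously differentiable, and $\Phi(\mathrm{gph}\,F\cap W)$ is the graph of a Lipschitz continuous mapping $f:U\to\mathbb{R}^n$ with $U\subseteq\mathbb{R}^n$ open. B-subdifferential: $\overline{\nabla}f(u):=\{B\mid\exists u_k\to u:\ f\text{ is Fréchet differentiable at }u_k\text{ and }B=\lim_{k}\nabla f(u_k)\}$. *)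

theory Defs
  imports "HOL-Analysis.Analysis"
begin

text \<open>
  The space of dimension \<open>2n\<close> is \<open>(real^'n) \<times> (real^'n)\<close> with \<open>n = CARD('n)\<close>; its product norm is the
  Euclidean one. Matrices of size \<open>2n \<times> 2n\<close> are linear maps on this space: transpose is \<open>adjoint\<close>,
  range is \<open>range\<close>, inverse is \<open>inv\<close>, product is composition, norm is \<open>onorm\<close>.
\<close>

definition gph :: "('a \<Rightarrow> 'b set) \<Rightarrow> ('a \<times> 'b) set" where
  "gph F = {(x, y). y \<in> F x}"

definition locally_closed_around :: "'a::topological_space set \<Rightarrow> 'a \<Rightarrow> bool" where
  "locally_closed_around A z \<longleftrightarrow> (\<exists>V. closed V \<and> z \<in> interior V \<and> closed (A \<inter> V))"

definition tangent_cone :: "'a::real_normed_vector set \<Rightarrow> 'a \<Rightarrow> 'a set" where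
  "tangent_cone A z = {w. \<exists>(t::nat \<Rightarrow> real) v. (\<forall>k. t k > 0) \<and> t \<longlonglongrightarrow> 0 \<and> v \<longlonglongrightarrow> w \<and>
     (\<forall>k. z + t k *\<^sub>R v k \<in> A)}"

definition orth_proj :: "'a::euclidean_space set \<Rightarrow> 'a \<Rightarrow> 'a" where
  "orth_proj L z = (THE p. p \<in> L \<and> z - p \<in> orthogonal_comp L)"

definition half_dim_subspaces :: "((real^'n) \<times> (real^'n)) set set" where
  "half_dim_subspaces = {L. subspace L \<and> dim L = CARD('n)}"

definition subspace_dist :: "'a::euclidean_space set \<Rightarrow> 'a set \<Rightarrow> real" where
  "subspace_dist L1 L2 = onorm (\<lambda>z. orth_proj L1 z - orth_proj L2 z)"

definition adj_subspace :: "((real^'n) \<times> (real^'n)) set \<Rightarrow> ((real^'n) \<times> (real^'n)) set" where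
  "adj_subspace L = {(- v, u) |u v. (u, v) \<in> orthogonal_comp L}"

text \<open>The block matrix with rows \<open>(0, -I)\<close> and \<open>(I, 0)\<close>.\<close>

definition S_mat :: "(real^'n) \<times> (real^'n) \<Rightarrow> (real^'n) \<times> (real^'n)" where
  "S_mat = (\<lambda>(u, v). (- v, u))"

text \<open>The \<open>2n \<times> n\<close> matrix with the identity stacked on top of \<open>B\<close>.\<close>

definition stack_id :: "real^'n^'n \<Rightarrow> real^'n \<Rightarrow> (real^'n) \<times> (real^'n)" where
  "stack_id B = (\<lambda>p. (p, B *v p))"

definition smooth_points :: "(real^'n \<Rightarrow> (real^'n) set) \<Rightarrow> ((real^'n) \<times> (real^'n)) set" where
  "smooth_points F = {z \<in> gph F. tangent_cone (gph F) z \<in> half_dim_subspaces}"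

definition SCD ::
  "(real^'n \<Rightarrow> (real^'n) set) \<Rightarrow> (real^'n) \<times> (real^'n) \<Rightarrow> ((real^'n) \<times> (real^'n)) set set" where
  "SCD F z = {L \<in> half_dim_subspaces. \<exists>\<zeta>. (\<forall>k::nat. \<zeta> k \<in> smooth_points F) \<and> \<zeta> \<longlonglongrightarrow> z \<and>
     (\<lambda>k. subspace_dist L (tangent_cone (gph F) (\<zeta> k))) \<longlonglongrightarrow> 0}"

definition SCD_adj ::
  "(real^'n \<Rightarrow> (real^'n) set) \<Rightarrow> (real^'n) \<times> (real^'n) \<Rightarrow> ((real^'n) \<times> (real^'n)) set set" where
  "SCD_adj F z = {L \<in> half_dim_subspaces. \<exists>\<zeta>. (\<forall>k::nat. \<zeta> k \<in> smooth_points F) \<and> \<zeta> \<longlonglongrightarrow> z \<and>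
     (\<lambda>k. subspace_dist L (adj_subspace (tangent_cone (gph F) (\<zeta> k)))) \<longlonglongrightarrow> 0}"

definition SCD_property_around ::
  "(real^'n \<Rightarrow> (real^'n) set) \<Rightarrow> (real^'n) \<times> (real^'n) \<Rightarrow> bool" where
  "SCD_property_around F z0 \<longleftrightarrow>
     (\<forall>\<^sub>F z in nhds z0. z \<in> gph F \<longrightarrow> SCD_adj F z \<noteq> {})"

text \<open>
  A mapping defined only on \<open>U\<close> is a HOL function together with \<open>U\<close>; as a multifunction it is
  empty-valued outside \<open>U\<close>, so values of the HOL function there are irrelevant.
\<close>

definition single_valued :: "'a set \<Rightarrow> ('a \<Rightarrow> 'b) \<Rightarrow> 'a \<Rightarrow> 'b set" where
  "single_valued U f = (\<lambda>u. if u \<in> U then {f u} else {})"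

definition SCD_fun ::
  "(real^'n) set \<Rightarrow> (real^'n \<Rightarrow> real^'n) \<Rightarrow> real^'n \<Rightarrow> ((real^'n) \<times> (real^'n)) set set" where
  "SCD_fun U f u = SCD (single_valued U f) (u, f u)"

definition SCD_adj_fun ::
  "(real^'n) set \<Rightarrow> (real^'n \<Rightarrow> real^'n) \<Rightarrow> real^'n \<Rightarrow> ((real^'n) \<times> (real^'n)) set set" where
  "SCD_adj_fun U f u = SCD_adj (single_valued U f) (u, f u)"

definition B_subdiff ::
  "(real^'n) set \<Rightarrow> (real^'n \<Rightarrow> real^'n) \<Rightarrow> real^'n \<Rightarrow> (real^'n^'n) set" where
  "B_subdiff U f u = {B. \<exists>x. (\<forall>k::nat. x k \<in> U \<and> f differentiable at (x k)) \<and> x \<longlonglongrightarrow> u \<and>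
     (\<lambda>k. jacobian f (at (x k))) \<longlonglongrightarrow> B}"

text \<open>Used for open \<open>S\<close> only; the derivative is continuous in the operator norm.\<close>

definition continuously_differentiable_on ::
  "('a::real_normed_vector \<Rightarrow> 'b::real_normed_vector) \<Rightarrow> 'a set \<Rightarrow> bool" where
  "continuously_differentiable_on f S \<longleftrightarrow>
     (\<exists>f' :: 'a \<Rightarrow> 'a \<Rightarrow>\<^sub>L 'b. (\<forall>x\<in>S. (f has_derivative blinfun_apply (f' x)) (at x)) \<and>
        continuous_on S f')"

text \<open>\<open>W\<close>, \<open>U\<close> and \<open>f\<close> are the neighborhood, the domain and the Lipschitz mapping that witness the
  property with transformation mapping \<open>\<Phi>\<close>, of which only the values on \<open>W\<close> matter.\<close>

definition graphically_lipschitzian ::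
  "(real^'n \<Rightarrow> (real^'n) set) \<Rightarrow> (real^'n) \<times> (real^'n) \<Rightarrow> ((real^'n) \<times> (real^'n) \<Rightarrow> (real^'n) \<times> (real^'n)) \<Rightarrow>
   ((real^'n) \<times> (real^'n)) set \<Rightarrow> (real^'n) set \<Rightarrow> (real^'n \<Rightarrow> real^'n) \<Rightarrow> bool" where
  "graphically_lipschitzian F z0 \<Phi> W U f \<longleftrightarrow>
     open W \<and> z0 \<in> W \<and> inj_on \<Phi> W \<and> open (\<Phi> ` W) \<and>
     continuously_differentiable_on \<Phi> W \<and>
     continuously_differentiable_on (the_inv_into W \<Phi>) (\<Phi> ` W) \<and>
     open U \<and> (\<exists>C. C-lipschitz_on U f) \<and>
     \<Phi> ` (gph F \<inter> W) = gph (single_valued U f)"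

end

theory Submission
  imports Defs
begin

text \<open>
  A diffeomorphism maps tangent cones to tangent cones by its derivative, so the tangent cone of
  \<open>gph F\<close> at \<open>z\<close> is the image under \<open>\<nabla>\<Phi>(z)\<^sup>-\<^sup>1\<close> of the tangent cone of the graph of \<open>f\<close> at \<open>\<Phi> z\<close>.
  Since \<open>f\<close> is Lipschitz, the latter is an \<open>n\<close>-dimensional subspace exactly where \<open>f\<close> is
  differentiable, and then it is the range of \<open>(I, \<nabla>f)\<close>. Jacobians are bounded by the Lipschitz
  constant, so from any sequence of smooth points a convergent sequence of Jacobians can be extracted;
  as \<open>A \<mapsto> range A\<close> is continuous at injective linear maps, limits of tangent spaces are
  the ranges for limits of Jacobians. The formulas for \<open>Sf\<close> are the case \<open>\<Phi> = id\<close>, and those for the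
  adjoint derivatives follow because \<open>L \<mapsto> L\<^sup>*\<close> is an isometric involution. Nonemptiness of the
  B-subdifferential is Rademacher's theorem.

  For Rademacher's theorem, the one-dimensional case comes from two applications of Vitali's covering
  theorem to the Stieltjes measure of an increasing function. It yields derivatives along each fixed
  direction almost everywhere. These are additive in the direction almost everywhere,
  because their integrals over every box are: the difference quotient along \<open>v + w\<close> is the one along
  \<open>v\<close> plus a translate of the one along \<open>w\<close>.
\<close>

section \<open>Rademacher's theorem\<close>

lemma slope_as_interval:
  fixes g :: "real \<Rightarrow> real" and x h :: real
  assumes "h \<noteq> 0"
  obtains c r where "0 < r" "r \<le> \<bar>h\<bar>" "x \<in> cball c r" "cball c r \<subseteq> cball x \<bar>h\<bar>"
    "g (c + r) - g (c - r) = (g (x + h) - g x) / h * (2 * r)"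
proof
  \<comment> \<open>Vitali's theorem works with closed balls, so the step from \<open>x\<close> to
    \<open>x + h\<close> becomes the ball with these two end points. It is centred at their
    midpoint, whatever the sign of \<open>h\<close>.\<close>
  let ?c = "x + h / 2" and ?r = "\<bar>h\<bar> / 2"
  show "0 < ?r" "?r \<le> \<bar>h\<bar>" using assms by auto
  show "x \<in> cball ?c ?r" by (simp add: dist_real_def)
  show "cball ?c ?r \<subseteq> cball x \<bar>h\<bar>"
    by (auto simp: dist_real_def abs_real_def split: if_splits)
  show "g (?c + ?r) - g (?c - ?r) = (g (x + h) - g x) / h * (2 * ?r)"
  proof (cases "h > 0")
    case True
    then have "?c + ?r = x + h" "?c - ?r = x" "2 * ?r = h" by (auto simp: field_simps)
    then show ?thesis using assms by (simp only:) simp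
  next
    case False
    then have "?c + ?r = x" "?c - ?r = x + h" "2 * ?r = - h" using assms by (auto simp: field_simps)
    then show ?thesis using assms by (simp only:) simp
  qed
qed

text \<open>Two nested Vitali coverings. The first consists of disjoint intervals inside a slightly
  larger open set on which \<open>g\<close> grows at most at rate \<open>p\<close>; the second lies
  inside the first and there \<open>g\<close> grows at least at rate \<open>q\<close>. Comparing the
  growth of \<open>g\<close> over both families gives q|E| \<le> p|E| up to an arbitrarily small
  error, and p < q forces |E| = 0.\<close>

lemma null_sets_two_slopes_bounded:
  fixes g :: "real \<Rightarrow> real"
  assumes mono: "\<And>x y. x \<le> y \<Longrightarrow> g x \<le> g y" and cont: "continuous_on UNIV g"
    and E: "E \<in> sets borel" "bounded E" and "p < q"
    and low: "\<And>x d. x \<in> E \<Longrightarrow> d > 0 \<Longrightarrow> \<exists>h. h \<noteq> 0 \<and> \<bar>h\<bar> < d \<and> (g (x + h) - g x) / h < p"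
    and up: "\<And>x d. x \<in> E \<Longrightarrow> d > 0 \<Longrightarrow> \<exists>h. h \<noteq> 0 \<and> \<bar>h\<bar> < d \<and> q < (g (x + h) - g x) / h"
  shows "E \<in> null_sets lborel"
proof (cases "E = {}")
  case False
  then obtain x0 where "x0 \<in> E" by auto
  then obtain h0 where h0: "h0 \<noteq> 0" "(g (x0 + h0) - g x0) / h0 < p" using low[of x0 1] by auto
  \<comment> \<open>Slopes of a monotone function are nonnegative, so one slope below
    \<open>p\<close> makes \<open>p\<close>, and then \<open>q\<close>, positive.\<close>
  have "0 \<le> (g (x0 + h0) - g x0) / h0"
    using mono[of x0 "x0 + h0"] mono[of "x0 + h0" x0] h0(1)
    by (cases "h0 > 0") (auto simp: divide_simps)
  with h0 have "p > 0" by simp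
  with \<open>p < q\<close> have "q > 0" by simp
  \<comment> \<open>The Stieltjes measure turns increments of \<open>g\<close> over intervals into a
    countably additive quantity.\<close>
  define \<mu> where "\<mu> = interval_measure g"
  have sets_\<mu>[simp]: "sets \<mu> = sets borel" by (simp add: \<mu>_def)
  let ?B = "\<lambda>i::real \<times> real. cball (fst i) (snd i)"
  have \<mu>_ball: "emeasure \<mu> (?B i) = ennreal (g (fst i + snd i) - g (fst i - snd i))" if "snd i > 0" for i
    using that unfolding \<mu>_def cball_eq_atLeastAtMost
    by (intro emeasure_interval_measure_Icc mono cont) auto
  have l_ball: "emeasure lborel (?B i) = ennreal (2 * snd i)" if "snd i > 0" for i
    using that by (simp add: cball_eq_atLeastAtMost)
  have sum_count: "emeasure M (\<Union>i\<in>C. ?B i) = (\<integral>\<^sup>+i. emeasure M (?B i) \<partial>count_space C)"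
    if "countable C" "pairwise (\<lambda>i j. disjnt (?B i) (?B j)) C" "sets M = sets borel" for C and M :: "real measure"
    using that by (intro emeasure_UN_countable)
      (auto simp: disjoint_family_on_def pairwise_def disjnt_def)
  have fin: "emeasure lborel E < \<infinity>"
    using E emeasure_bounded_finite by (simp)
  have key: "q * measure lborel E \<le> p * (measure lborel E + e)" if "e > 0" for e :: real
  proof -
    obtain V where V: "open V" "E \<subseteq> V" "emeasure lborel (V - E) < ennreal e"
      using outer_regular_lborel[OF E(1) \<open>e > 0\<close>] by metis
    have mV: "emeasure lborel V \<le> ennreal (measure lborel E + e)"
    proof -
      have "emeasure lborel V = emeasure lborel (E \<union> (V - E))" using V(2) by (simp add: Un_absorb1)
      also have "\<dots> \<le> emeasure lborel E + emeasure lborel (V - E)"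
        using E(1) V(1) by (intro emeasure_subadditive) auto
      also have "\<dots> \<le> emeasure lborel E + ennreal e" using V(3) by (intro add_left_mono) auto
      also have "\<dots> = ennreal (measure lborel E + e)"
        using fin \<open>e > 0\<close> by (simp add: emeasure_eq_ennreal_measure ennreal_plus)
      finally show ?thesis .
    qed
    \<comment> \<open>An index is a pair of centre and radius. Confinement to \<open>V\<close> is
      what later bounds the total length by |E| + e.\<close>
    define K1 where "K1 = {i. snd i > 0 \<and> ?B i \<subseteq> V \<and> g (fst i + snd i) - g (fst i - snd i) \<le> p * (2 * snd i)}"
    have S1: "\<exists>i. i \<in> K1 \<and> x \<in> ?B i \<and> snd i < d" if "x \<in> E" "d > 0" for x d
    proof -
      obtain d' where d': "d' > 0" "ball x d' \<subseteq> V" using V \<open>x \<in> E\<close> by (meson openE subsetD)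
      obtain h where h: "h \<noteq> 0" "\<bar>h\<bar> < min d d'" "(g (x + h) - g x) / h < p"
        using low[OF \<open>x \<in> E\<close>, of "min d d'"] \<open>d > 0\<close> d' by auto
      obtain c r where cr: "0 < r" "r \<le> \<bar>h\<bar>" "x \<in> cball c r" "cball c r \<subseteq> cball x \<bar>h\<bar>"
        and sl: "g (c + r) - g (c - r) = (g (x + h) - g x) / h * (2 * r)"
        using slope_as_interval[OF h(1)] by blast
      have "cball x \<bar>h\<bar> \<subseteq> V" using d' h(2) by (auto simp: subset_eq)
      then show ?thesis using cr h mult_right_mono[of "(g (x + h) - g x) / h" p "2 * r"] unfolding K1_def
        by (intro exI[of _ "(c, r)"]) (auto simp: sl)
    qed
    obtain C1 where C1: "countable C1" "C1 \<subseteq> K1" "pairwise (\<lambda>i j. disjnt (?B i) (?B j)) C1"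
      "negligible (E - (\<Union>i\<in>C1. ?B i))"
      using Vitali_covering_theorem_cballs[of K1 snd E fst] S1 by (auto simp: K1_def)
    \<comment> \<open>A point in the open ball has room for small intervals that stay inside the
      same interval of the first family; this makes the second covering fine.\<close>
    define E1 where "E1 = E \<inter> (\<Union>i\<in>C1. ball (fst i) (snd i))"
    define K2 where "K2 = {i. snd i > 0 \<and> (\<exists>j\<in>C1. ?B i \<subseteq> ?B j) \<and> q * (2 * snd i) \<le> g (fst i + snd i) - g (fst i - snd i)}"
    have S2: "\<exists>i. i \<in> K2 \<and> x \<in> ?B i \<and> snd i < d" if "x \<in> E1" "d > 0" for x d
    proof -
      obtain j where j: "j \<in> C1" "x \<in> ball (fst j) (snd j)" "x \<in> E" using \<open>x \<in> E1\<close> by (auto simp: E1_def)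
      obtain d' where d': "d' > 0" "ball x d' \<subseteq> ball (fst j) (snd j)"
        using j by (meson openE open_ball)
      obtain h where h: "h \<noteq> 0" "\<bar>h\<bar> < min d d'" "q < (g (x + h) - g x) / h"
        using up[OF \<open>x \<in> E\<close>, of "min d d'"] \<open>d > 0\<close> d' by auto
      obtain c r where cr: "0 < r" "r \<le> \<bar>h\<bar>" "x \<in> cball c r" "cball c r \<subseteq> cball x \<bar>h\<bar>"
        and sl: "g (c + r) - g (c - r) = (g (x + h) - g x) / h * (2 * r)"
        using slope_as_interval[OF h(1)] by blast
      have "cball x \<bar>h\<bar> \<subseteq> ball x d'" using h(2) by (auto simp: subset_eq)
      then have "cball x \<bar>h\<bar> \<subseteq> ?B j" using d' by (meson ball_subset_cball order_trans)
      then have "\<exists>j\<in>C1. cball c r \<subseteq> ?B j" using cr(4) j(1) by blast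
      then show ?thesis using cr h mult_right_mono[of q "(g (x + h) - g x) / h" "2 * r"] unfolding K2_def
        by (intro exI[of _ "(c, r)"]) (auto simp: sl)
    qed
    obtain C2 where C2: "countable C2" "C2 \<subseteq> K2" "pairwise (\<lambda>i j. disjnt (?B i) (?B j)) C2"
      "negligible (E1 - (\<Union>i\<in>C2. ?B i))"
      using Vitali_covering_theorem_cballs[of K2 snd E1 fst] S2 by (auto simp: K2_def)
    have pos1: "snd i > 0" if "i \<in> C1" for i using that C1 by (auto simp: K1_def)
    have pos2: "snd i > 0" if "i \<in> C2" for i using that C2 by (auto simp: K2_def)
    let ?U1 = "\<Union>i\<in>C1. ?B i" and ?U2 = "\<Union>i\<in>C2. ?B i"
    have meas1: "?U1 \<in> sets borel" using C1(1) by (intro sets.countable_UN') auto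
    have meas2: "?U2 \<in> sets borel" using C2(1) by (intro sets.countable_UN') auto
    \<comment> \<open>Passing from closed to open balls loses only the end points of countably many
      intervals.\<close>
    have "E - E1 \<subseteq> (E - ?U1) \<union> (\<Union>i\<in>C1. {fst i - snd i, fst i + snd i})"
      by (fastforce simp: E1_def dist_real_def abs_real_def split: if_splits)
    moreover have "negligible (\<Union>i\<in>C1. {fst i - snd i, fst i + snd i})"
      unfolding negligible_iff_null_sets using C1(1)
      by (intro null_sets_completionI countable_imp_null_set_lborel countable_UN) auto
    ultimately have "negligible (E - E1)"
      using C1(4) by (meson negligible_Un negligible_subset)
    then have "negligible (E - ?U2)"
      using C2(4) by (rule negligible_subset[OF negligible_Un]) auto
    then have null: "E - ?U2 \<in> null_sets lborel"
      using E meas2 by (simp add: negligible_iff_null_sets null_sets_completion_iff)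
    have "emeasure lborel E \<le> emeasure lborel (?U2 \<union> (E - ?U2))"
      using meas2 E by (intro emeasure_mono) auto
    also have "\<dots> = emeasure lborel ?U2"
      using null meas2 by (intro emeasure_Un_null_set) simp_all
    finally have EU2: "emeasure lborel E \<le> emeasure lborel ?U2" .
    \<comment> \<open>The chain runs through the Stieltjes measure: q|E| \<le> q|U2| \<le> \<mu>(U2)
      \<le> \<mu>(U1) \<le> p|U1| \<le> p|V|, where U1 and U2 are the unions of the two
      families.\<close>
    have "ennreal q * emeasure lborel E \<le> ennreal q * (\<integral>\<^sup>+i. emeasure lborel (?B i) \<partial>count_space C2)"
      using EU2 sum_count[OF C2(1,3)] by (simp add: mult_left_mono)
    also have "\<dots> = (\<integral>\<^sup>+i. ennreal q * emeasure lborel (?B i) \<partial>count_space C2)"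
      by (simp add: nn_integral_cmult)
    also have "\<dots> \<le> (\<integral>\<^sup>+i. emeasure \<mu> (?B i) \<partial>count_space C2)"
    proof (intro nn_integral_mono)
      fix i assume "i \<in> space (count_space C2)"
      then have "i \<in> C2" by simp
      then show "ennreal q * emeasure lborel (?B i) \<le> emeasure \<mu> (?B i)"
        using C2(2) pos2[of i] \<open>q > 0\<close>
        by (auto simp: \<mu>_ball l_ball K2_def ennreal_mult[symmetric] intro!: ennreal_leI)
    qed
    also have "\<dots> = emeasure \<mu> ?U2" by (rule sum_count[symmetric, OF C2(1,3) sets_\<mu>])
    also have "\<dots> \<le> emeasure \<mu> ?U1"
    proof (rule emeasure_mono)
      show "?U2 \<subseteq> ?U1" using C2(2) unfolding K2_def by blast
    qed (use meas1 in simp)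
    also have "\<dots> = (\<integral>\<^sup>+i. emeasure \<mu> (?B i) \<partial>count_space C1)" by (rule sum_count[OF C1(1,3) sets_\<mu>])
    also have "\<dots> \<le> (\<integral>\<^sup>+i. ennreal p * emeasure lborel (?B i) \<partial>count_space C1)"
    proof (intro nn_integral_mono)
      fix i assume "i \<in> space (count_space C1)"
      then have "i \<in> C1" by simp
      then show "emeasure \<mu> (?B i) \<le> ennreal p * emeasure lborel (?B i)"
        using C1(2) pos1[of i] \<open>p > 0\<close>
        by (auto simp: \<mu>_ball l_ball K1_def ennreal_mult[symmetric] intro!: ennreal_leI)
    qed
    also have "\<dots> = ennreal p * (\<integral>\<^sup>+i. emeasure lborel (?B i) \<partial>count_space C1)"
      by (simp add: nn_integral_cmult)
    also have "\<dots> = ennreal p * emeasure lborel ?U1"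
      using sum_count[OF C1(1,3), of lborel] by simp
    also have "\<dots> \<le> ennreal p * emeasure lborel V"
    proof (intro mult_left_mono emeasure_mono)
      show "?U1 \<subseteq> V" using C1(2) unfolding K1_def by blast
    qed (use V(1) in simp_all)
    also have "\<dots> \<le> ennreal p * ennreal (measure lborel E + e)" using mV by (intro mult_left_mono) auto
    finally have "ennreal (q * measure lborel E) \<le> ennreal (p * (measure lborel E + e))"
      using fin \<open>p > 0\<close> \<open>q > 0\<close> \<open>e > 0\<close>
      by (simp add: emeasure_eq_ennreal_measure ennreal_mult)
    then show ?thesis using \<open>p > 0\<close> \<open>e > 0\<close> by (subst (asm) ennreal_le_iff) auto
  qed
  have "measure lborel E = 0"
  proof (rule ccontr)
    assume "measure lborel E \<noteq> 0"
    then have m: "measure lborel E > 0" using zero_less_measure_iff by blast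
    \<comment> \<open>Chosen so that p e is half of (q - p)|E|, which contradicts \<open>key\<close>
      if |E| > 0.\<close>
    define e where "e = (q - p) * measure lborel E / (2 * p)"
    have "e > 0" using m \<open>p < q\<close> \<open>p > 0\<close> by (simp add: e_def)
    have "q * measure lborel E \<le> p * (measure lborel E + e)" by (rule key[OF \<open>e > 0\<close>])
    moreover have "p * e = (q - p) * measure lborel E / 2" using \<open>p > 0\<close> by (simp add: e_def)
    moreover have "(q - p) * measure lborel E > 0" using m \<open>p < q\<close> by simp
    ultimately show False by (simp add: algebra_simps)
  qed
  then show ?thesis using fin E by (simp add: null_sets_def emeasure_eq_ennreal_measure)
qed auto

text \<open>Adding C x makes a C-Lipschitz function increasing and shifts every slope by C, so the
  monotone case applies.\<close>

lemma null_sets_two_slopes: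
  fixes g :: "real \<Rightarrow> real"
  assumes lip: "C-lipschitz_on UNIV g"
    and E: "E \<in> sets borel" "bounded E" and "p < q"
    and low: "\<And>x d. x \<in> E \<Longrightarrow> d > 0 \<Longrightarrow> \<exists>h. h \<noteq> 0 \<and> \<bar>h\<bar> < d \<and> (g (x + h) - g x) / h < p"
    and up: "\<And>x d. x \<in> E \<Longrightarrow> d > 0 \<Longrightarrow> \<exists>h. h \<noteq> 0 \<and> \<bar>h\<bar> < d \<and> q < (g (x + h) - g x) / h"
  shows "E \<in> null_sets lborel"
proof (rule null_sets_two_slopes_bounded[where g = "\<lambda>x. g x + C * x" and p = "p + C" and q = "q + C"])
  have slope: "(g (x + h) + C * (x + h) - (g x + C * x)) / h = (g (x + h) - g x) / h + C"
    if "h \<noteq> 0" for x h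
    using that by (simp add: field_simps)
  show "\<exists>h. h \<noteq> 0 \<and> \<bar>h\<bar> < d \<and> (g (x + h) + C * (x + h) - (g x + C * x)) / h < p + C"
    if x: "x \<in> E" "d > 0" for x d
    using low[OF x] by (auto simp: slope)
  show "\<exists>h. h \<noteq> 0 \<and> \<bar>h\<bar> < d \<and> q + C < (g (x + h) + C * (x + h) - (g x + C * x)) / h"
    if x: "x \<in> E" "d > 0" for x d
    using up[OF x] by (auto simp: slope)
  show "continuous_on UNIV (\<lambda>x. g x + C * x)"
    using lipschitz_on_continuous_on[OF lip] by (intro continuous_intros)
  show "g x + C * x \<le> g y + C * y" if "x \<le> y" for x y
    using lipschitz_onD[OF lip, of x y] that
    by (simp add: dist_real_def algebra_simps abs_le_iff)
qed (use assms in auto)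

text \<open>The limit is the supremum of the eventual lower bounds, that is, the lower limit. A
  rational above it is no eventual lower bound, so the alternative makes every larger rational an
  eventual upper bound. Rational thresholds keep the exceptional sets countable in number.\<close>

lemma tendsto_if_no_two_slopes:
  fixes s :: "real \<Rightarrow> real"
  assumes bounded: "\<forall>\<^sub>F h in F. \<bar>s h\<bar> \<le> K" and F: "F \<noteq> bot"
    and alt: "\<And>p q. p \<in> \<rat> \<Longrightarrow> q \<in> \<rat> \<Longrightarrow> p < q \<Longrightarrow> (\<forall>\<^sub>F h in F. p \<le> s h) \<or> (\<forall>\<^sub>F h in F. s h \<le> q)"
  shows "\<exists>D. (s \<longlongrightarrow> D) F"
proof -
  define A where "A = {p. \<forall>\<^sub>F h in F. p \<le> s h}"
  have "- K \<in> A" unfolding A_def using bounded by (auto elim!: eventually_mono)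
  then have ne: "A \<noteq> {}" by auto
  have "p \<le> K" if "p \<in> A" for p
  proof -
    have "\<forall>\<^sub>F h in F. p \<le> K" using that bounded unfolding A_def by (auto elim: eventually_elim2)
    then show ?thesis using F by simp
  qed
  then have bdd: "bdd_above A" by (auto simp: bdd_above_def)
  have "(s \<longlongrightarrow> Sup A) F"
  proof (rule order_tendstoI)
    fix a assume "a < Sup A"
    then obtain p where "p \<in> A" "a < p" using less_cSup_iff[OF ne bdd] by auto
    then show "\<forall>\<^sub>F h in F. a < s h" unfolding A_def by (auto elim!: eventually_mono)
  next
    fix a assume "Sup A < a"
    then obtain q where q: "q \<in> \<rat>" "Sup A < q" "q < a" using Rats_dense_in_real by blast
    then obtain p where p: "p \<in> \<rat>" "Sup A < p" "p < q" using Rats_dense_in_real by blast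
    have "p \<notin> A" using p(2) cSup_upper[OF _ bdd, of p] by auto
    then have "\<forall>\<^sub>F h in F. s h \<le> q" using alt[OF p(1) q(1) p(3)] by (auto simp: A_def)
    then show "\<forall>\<^sub>F h in F. s h < a" using q(3) by (auto elim!: eventually_mono)
  qed
  then show ?thesis by blast
qed

section \<open>Directional derivatives exist almost everywhere\<close>

text \<open>Averaging over translates along \<open>v\<close> replaces a rotation of coordinates.\<close>

lemma null_sets_if_null_on_lines:
  fixes E :: "'a::euclidean_space set"
  assumes E: "E \<in> sets borel"
    and line: "\<And>x. {t \<in> {0..1}. x + t *\<^sub>R v \<in> E} \<in> null_sets lborel"
  shows "E \<in> null_sets lborel"
proof -
  have inner: "(\<integral>\<^sup>+x. indicator {0..1::real} t * indicator E (x + t *\<^sub>R v) \<partial>lborel)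
      = indicator {0..1} t * emeasure lborel E" for t
  proof -
    have "(\<integral>\<^sup>+x. indicator E (t *\<^sub>R v + x) \<partial>lborel) = (\<integral>\<^sup>+x. indicator E x \<partial>distr lborel borel ((+) (t *\<^sub>R v)))"
      using E by (subst nn_integral_distr) auto
    also have "\<dots> = emeasure lborel E" using E by (simp add: lborel_distr_plus)
    finally show ?thesis using E by (subst nn_integral_cmult) (auto simp: add.commute)
  qed
  have meas: "(\<lambda>(x::'a, t::real). indicator {0..1::real} t * indicator E (x + t *\<^sub>R v) :: ennreal)
      \<in> borel_measurable (lborel \<Otimes>\<^sub>M lborel)"
    using E by measurable
  \<comment> \<open>Tonelli on the product with [0,1]: integrating first over \<open>x\<close> gives
    |E| for each \<open>t\<close> by translation invariance, integrating first over \<open>t\<close>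
    gives 0 by the assumption on lines.\<close>
  have "emeasure lborel E = (\<integral>\<^sup>+t. indicator {0..1::real} t * emeasure lborel E \<partial>lborel)"
    by (simp add: nn_integral_multc)
  also have "\<dots> = (\<integral>\<^sup>+t. (\<integral>\<^sup>+x. indicator {0..1::real} t * indicator E (x + t *\<^sub>R v) \<partial>lborel) \<partial>lborel)"
    by (simp add: inner)
  also have "\<dots> = (\<integral>\<^sup>+x. (\<integral>\<^sup>+t. indicator {0..1::real} t * indicator E (x + t *\<^sub>R v) \<partial>lborel) \<partial>lborel)"
    by (rule lborel_pair.Fubini'[OF meas])
  also have "\<dots> = (\<integral>\<^sup>+x. (\<integral>\<^sup>+t. indicator {t \<in> {0..1::real}. x + t *\<^sub>R v \<in> E} t \<partial>lborel) \<partial>(lborel::'a measure))"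
    by (intro nn_integral_cong) (auto simp: indicator_def)
  also have "\<dots> = (\<integral>\<^sup>+x. 0 \<partial>(lborel::'a measure))"
    using line by (intro nn_integral_cong) (auto simp: null_sets_def)
  finally show ?thesis using E by (simp add: null_sets_def)
qed

text \<open>For fixed \<open>n\<close> the union over the uncountably many steps \<open>h\<close> is
  still open by continuity of \<open>f\<close>; only the intersection over \<open>n\<close> has to
  be countable.\<close>

lemma borel_frequently_slope:
  fixes f :: "'a::euclidean_space \<Rightarrow> real"
  assumes cont: "continuous_on UNIV f"
  shows "{x. \<forall>n. \<exists>h. h \<noteq> 0 \<and> \<bar>h\<bar> < 1 / real (Suc n) \<and> (f (x + h *\<^sub>R v) - f x) / h < p} \<in> sets borel" (is ?A)
    and "{x. \<forall>n. \<exists>h. h \<noteq> 0 \<and> \<bar>h\<bar> < 1 / real (Suc n) \<and> p < (f (x + h *\<^sub>R v) - f x) / h} \<in> sets borel" (is ?B)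
proof -
  have c: "continuous_on UNIV (\<lambda>x. (f (x + h *\<^sub>R v) - f x) / h)" if "h \<noteq> 0" for h
    using that by (intro continuous_intros continuous_on_compose2[OF cont]) auto
  have "{x. \<forall>n. \<exists>h. h \<noteq> 0 \<and> \<bar>h\<bar> < 1 / real (Suc n) \<and> (f (x + h *\<^sub>R v) - f x) / h < p}
      = (\<Inter>n. \<Union>h\<in>{h. h \<noteq> 0 \<and> \<bar>h\<bar> < 1 / real (Suc n)}. {x. (f (x + h *\<^sub>R v) - f x) / h < p})"
    by auto
  moreover have "open {x. (f (x + h *\<^sub>R v) - f x) / h < p}" if "h \<noteq> 0" for h
    by (intro open_Collect_less c that continuous_intros)
  ultimately show ?A by (simp only:) (intro sets.countable_INT'' borel_open open_UN ballI; simp)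
  have "{x. \<forall>n. \<exists>h. h \<noteq> 0 \<and> \<bar>h\<bar> < 1 / real (Suc n) \<and> p < (f (x + h *\<^sub>R v) - f x) / h}
      = (\<Inter>n. \<Union>h\<in>{h. h \<noteq> 0 \<and> \<bar>h\<bar> < 1 / real (Suc n)}. {x. p < (f (x + h *\<^sub>R v) - f x) / h})"
    by auto
  moreover have "open {x. p < (f (x + h *\<^sub>R v) - f x) / h}" if "h \<noteq> 0" for h
    by (intro open_Collect_less c that continuous_intros)
  ultimately show ?B by (simp only:) (intro sets.countable_INT'' borel_open open_UN ballI; simp)
qed

lemma lipschitz_slope_bound:
  fixes f :: "'a::euclidean_space \<Rightarrow> real"
  assumes lip: "C-lipschitz_on UNIV f"
  shows "\<bar>(f (x + h *\<^sub>R v) - f x) / h\<bar> \<le> C * norm v"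
proof (cases "h = 0")
  case False
  have "\<bar>f (x + h *\<^sub>R v) - f x\<bar> \<le> C * (\<bar>h\<bar> * norm v)"
    using lipschitz_onD[OF lip, of "x + h *\<^sub>R v" x] by (simp add: dist_norm)
  then show ?thesis using False by (simp add: field_simps)
qed (use lipschitz_on_nonneg[OF lip] in auto)

text \<open>Bounded quotients fail to converge only if, for some rationals p < q, they drop below
  \<open>p\<close> and also exceed \<open>q\<close> at arbitrarily small steps. On each line in
  direction \<open>v\<close> the set of such points is null by the one-variable result, hence it is
  null.\<close>

lemma AE_directionally_differentiable:
  fixes f :: "'a::euclidean_space \<Rightarrow> real"
  assumes lip: "C-lipschitz_on UNIV f"
  shows "AE x in lborel. \<exists>D. ((\<lambda>h. (f (x + h *\<^sub>R v) - f x) / h) \<longlongrightarrow> D) (at 0)"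
proof -
  define Lo where "Lo p = {x. \<forall>n. \<exists>h. h \<noteq> 0 \<and> \<bar>h\<bar> < 1 / real (Suc n) \<and> (f (x + h *\<^sub>R v) - f x) / h < p}" for p
  define Up where "Up p = {x. \<forall>n. \<exists>h. h \<noteq> 0 \<and> \<bar>h\<bar> < 1 / real (Suc n) \<and> p < (f (x + h *\<^sub>R v) - f x) / h}" for p
  have small: "\<exists>n. 1 / real (Suc n) < d" if "d > 0" for d :: real
    using nat_approx_posE that by metis
  have cont: "continuous_on UNIV f" using lipschitz_on_continuous_on[OF lip] .
  have meas: "Lo p \<inter> Up q \<in> sets borel" for p q
    unfolding Lo_def Up_def by (intro sets.Int borel_frequently_slope[OF cont])
  have null: "Lo p \<inter> Up q \<in> null_sets lborel" if "p < q" for p q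
  proof (rule null_sets_if_null_on_lines[OF meas])
    fix x
    let ?g = "\<lambda>t. f (x + t *\<^sub>R v)"
    have slope: "(?g (t + h) - ?g t) / h = (f (x + t *\<^sub>R v + h *\<^sub>R v) - f (x + t *\<^sub>R v)) / h" for t h
      by (simp add: algebra_simps)
    show "{t \<in> {0..1}. x + t *\<^sub>R v \<in> Lo p \<inter> Up q} \<in> null_sets lborel"
    proof (rule null_sets_two_slopes[OF _ _ _ \<open>p < q\<close>])
      show "(C * norm v)-lipschitz_on UNIV ?g"
      proof (rule lipschitz_onI)
        show "dist (?g s) (?g t) \<le> C * norm v * dist s t" for s t
          using lipschitz_onD[OF lip, of "x + s *\<^sub>R v" "x + t *\<^sub>R v"]
          by (simp add: dist_norm scaleR_diff_left[symmetric] mult_ac)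
      qed (use lipschitz_on_nonneg[OF lip] in auto)
      have "(\<lambda>t. x + t *\<^sub>R v) -` (Lo p \<inter> Up q) \<inter> space borel \<in> sets borel"
        by (rule measurable_sets[OF _ meas]) measurable
      then have "{0..1} \<inter> ((\<lambda>t. x + t *\<^sub>R v) -` (Lo p \<inter> Up q)) \<in> sets borel" by auto
      then show "{t \<in> {0..1}. x + t *\<^sub>R v \<in> Lo p \<inter> Up q} \<in> sets borel"
        by (simp add: vimage_def Int_def)
      show "bounded {t \<in> {0..1::real}. x + t *\<^sub>R v \<in> Lo p \<inter> Up q}"
        by (rule bounded_subset[of "{0..1}"]) auto
      fix t d assume t: "t \<in> {t \<in> {0..1}. x + t *\<^sub>R v \<in> Lo p \<inter> Up q}" and "d > (0::real)"
      then obtain n where n: "1 / real (Suc n) < d" using small by blast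
      show "\<exists>h. h \<noteq> 0 \<and> \<bar>h\<bar> < d \<and> (?g (t + h) - ?g t) / h < p"
      proof -
        have "x + t *\<^sub>R v \<in> Lo p" using t by simp
        then show ?thesis unfolding slope Lo_def using order.strict_trans[OF _ n] by blast
      qed
      show "\<exists>h. h \<noteq> 0 \<and> \<bar>h\<bar> < d \<and> q < (?g (t + h) - ?g t) / h"
      proof -
        have "x + t *\<^sub>R v \<in> Up q" using t by simp
        then show ?thesis unfolding slope Up_def using order.strict_trans[OF _ n] by blast
      qed
    qed
  qed
  \<comment> \<open>Countably many rational pairs allow one null set for all of them.\<close>
  have "AE x in lborel. \<forall>pq\<in>{pq. fst pq \<in> \<rat> \<and> snd pq \<in> \<rat> \<and> fst pq < snd pq}. x \<notin> Lo (fst pq) \<inter> Up (snd pq)"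
  proof (subst AE_ball_countable)
    have "{pq. fst pq \<in> \<rat> \<and> snd pq \<in> \<rat> \<and> fst pq < snd pq} \<subseteq> (\<rat> \<times> \<rat> :: (real \<times> real) set)" by auto
    then show "countable {pq::real \<times> real. fst pq \<in> \<rat> \<and> snd pq \<in> \<rat> \<and> fst pq < snd pq}"
      using countable_rat by (meson countable_SIGMA countable_subset)
    show "\<forall>pq\<in>{pq. fst pq \<in> \<rat> \<and> snd pq \<in> \<rat> \<and> fst pq < snd pq}. AE x in lborel. x \<notin> Lo (fst pq) \<inter> Up (snd pq)"
      by (intro ballI AE_not_in null) simp
  qed
  then show ?thesis
  proof eventually_elim
    case (elim x)
    show ?case
    proof (rule tendsto_if_no_two_slopes)
      show "\<forall>\<^sub>F h in at 0. \<bar>(f (x + h *\<^sub>R v) - f x) / h\<bar> \<le> C * norm v"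
        by (intro always_eventually allI lipschitz_slope_bound[OF lip])
      fix p q :: real assume pq: "p \<in> \<rat>" "q \<in> \<rat>" "p < q"
      have "x \<notin> Lo p \<inter> Up q" using bspec[OF elim, of "(p, q)"] pq by simp
      then consider "x \<notin> Lo p" | "x \<notin> Up q" by blast
      then show "(\<forall>\<^sub>F h in at 0. p \<le> (f (x + h *\<^sub>R v) - f x) / h) \<or> (\<forall>\<^sub>F h in at 0. (f (x + h *\<^sub>R v) - f x) / h \<le> q)"
      proof cases
        case 1
        then obtain n where n: "\<And>h. h \<noteq> 0 \<Longrightarrow> \<bar>h\<bar> < 1 / real (Suc n) \<Longrightarrow> \<not> (f (x + h *\<^sub>R v) - f x) / h < p"
          unfolding Lo_def by blast
        have "\<forall>\<^sub>F h in at 0. p \<le> (f (x + h *\<^sub>R v) - f x) / h"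
          unfolding eventually_at dist_real_def
          by (intro exI[of _ "1 / real (Suc n)"]) (use n in \<open>simp add: not_less\<close>)
        then show ?thesis ..
      next
        case 2
        then obtain n where n: "\<And>h. h \<noteq> 0 \<Longrightarrow> \<bar>h\<bar> < 1 / real (Suc n) \<Longrightarrow> \<not> q < (f (x + h *\<^sub>R v) - f x) / h"
          unfolding Up_def by blast
        have "\<forall>\<^sub>F h in at 0. (f (x + h *\<^sub>R v) - f x) / h \<le> q"
          unfolding eventually_at dist_real_def
          by (intro exI[of _ "1 / real (Suc n)"]) (use n in \<open>simp add: not_less\<close>)
        then show ?thesis ..
      qed
    qed simp
  qed
qed

section \<open>Additivity and linearity of the directional derivative in the direction\<close>

lemma AE_zero_if_box_integrals_zero:
  fixes k :: "'a::euclidean_space \<Rightarrow> real"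
  assumes k[measurable]: "k \<in> borel_measurable borel" and bound: "\<And>x. \<bar>k x\<bar> \<le> K"
    and zero: "\<And>l u. (LINT x|lborel. indicator (box l u) x * k x) = 0"
  shows "AE x in lborel. k x = 0"
proof -
  \<comment> \<open>The summand 1 keeps \<open>c\<close> positive even for K = 0, so that division
    by \<open>c\<close> is possible.\<close>
  define c where "c = K + 1"
  have c: "c > 0" "\<And>x. 0 \<le> k x + c"
  proof -
    have "0 \<le> K" using bound[of undefined] by linarith
    then show "c > 0" by (simp add: c_def)
    show "0 \<le> k x + c" for x using bound[of x] by (simp add: c_def abs_le_iff)
  qed
  \<comment> \<open>The density \<open>w\<close> is nonnegative and integrates over every box to its
    volume, so it defines Lebesgue measure again. Uniqueness of densities gives w = 1, that is k =
    0, almost everywhere.\<close>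
  define w where "w x = (k x + c) / c" for x
  have w0: "0 \<le> w x" for x using c by (simp add: w_def)
  have w[measurable]: "w \<in> borel_measurable borel" unfolding w_def by measurable
  have int1: "integrable lborel (\<lambda>x. indicator (box l u) x * (1::real))" for l u :: 'a
    using emeasure_bounded_finite[OF bounded_box, of l u] by (auto intro!: integrable_real_indicator)
  have intk: "integrable lborel (\<lambda>x. indicator (box l u) x * k x)" for l u
    by (rule Bochner_Integration.integrable_bound[where f = "\<lambda>x. K * (indicator (box l u) x * (1::real))"])
       (use int1 bound in \<open>auto simp: indicator_def intro!: AE_I2 intro: order_trans[OF _ abs_ge_self]\<close>)
  have "lborel = density lborel (\<lambda>x. ennreal (w x))"
  proof (rule lborel_eqI)
    fix l u :: 'a assume le: "\<And>b. b \<in> Basis \<Longrightarrow> l \<bullet> b \<le> u \<bullet> b"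
    have eq: "w x * indicator (box l u) x = indicator (box l u) x * (1::real) + (1 / c) * (indicator (box l u) x * k x)" for x
      using c by (simp add: w_def indicator_def field_simps)
    have "emeasure (density lborel (\<lambda>x. ennreal (w x))) (box l u) = (\<integral>\<^sup>+x. ennreal (w x * indicator (box l u) x) \<partial>lborel)"
      by (subst emeasure_density) (auto simp: ennreal_mult w0 indicator_def intro!: nn_integral_cong)
    also have "\<dots> = ennreal (LINT x|lborel. w x * indicator (box l u) x)"
    proof (rule nn_integral_eq_integral)
      show "integrable lborel (\<lambda>x. w x * indicator (box l u) x)"
        unfolding eq using int1 intk by (intro Bochner_Integration.integrable_add integrable_mult_right)
      show "AE x in lborel. 0 \<le> w x * indicator (box l u) x"
        by (intro AE_I2 mult_nonneg_nonneg w0) auto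
    qed
    also have "(LINT x|lborel. w x * indicator (box l u) x) = measure lborel (box l u)"
      unfolding eq using int1 intk zero
      by (subst Bochner_Integration.integral_add) auto
    also have "ennreal (measure lborel (box l u)) = emeasure lborel (box l u)"
      using emeasure_bounded_finite[OF bounded_box, of l u]
      by (intro emeasure_eq_ennreal_measure[symmetric]) auto
    also have "\<dots> = ennreal (\<Prod>b\<in>Basis. (u - l) \<bullet> b)" using le by (simp add: emeasure_lborel_box)
    finally show "emeasure (density lborel (\<lambda>x. ennreal (w x))) (box l u) = ennreal (\<Prod>b\<in>Basis. (u - l) \<bullet> b)" .
  qed simp
  then have "density lborel (\<lambda>x. 1) = density lborel (\<lambda>x. ennreal (w x))" by (simp add: density_1)
  then have "AE x in lborel. 1 = ennreal (w x)"
    by (intro sigma_finite_measure.density_unique[OF sigma_finite_lborel]) auto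
  then show ?thesis
  proof eventually_elim
    case (elim x)
    then have "w x = 1" using w0[of x] by (metis ennreal_eq_1)
    then show ?case using c by (simp add: w_def)
  qed
qed

text \<open>Pointwise convergence of \<open>H n\<close> at fixed points says nothing about the
  moving points \<open>x + a n\<close>. Translation invariance moves the shift from
  \<open>H n\<close> onto the box, whose indicator does converge off the boundary; then dominated
  convergence applies.\<close>

lemma box_integral_shift_tendsto:
  fixes h :: "'a::euclidean_space \<Rightarrow> real"
  assumes [measurable]: "\<And>n. H n \<in> borel_measurable borel" "h \<in> borel_measurable borel"
    and bound: "\<And>n x. \<bar>H n x\<bar> \<le> M"
    and lim: "AE x in lborel. (\<lambda>n. H n x) \<longlonglongrightarrow> h x" and a: "a \<longlonglongrightarrow> 0"
  shows "(\<lambda>n::nat. LINT x|lborel. indicator (box l u) x * H n (x + a n)) \<longlonglongrightarrow> (LINT x|lborel. indicator (box l u) x * h x)"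
proof -
  have shift: "(LINT x|lborel. indicator (box l u) x * H n (x + a n)) = (LINT x|lborel. indicator (box l u) (x - a n) * H n x)" for n
  proof -
    have "(LINT x|lborel. indicator (box l u) (x - a n) * H n x)
      = (LINT x|distr lborel borel ((+) (a n)). indicator (box l u) (x - a n) * H n x)"
      by (simp add: lborel_distr_plus)
    also have "\<dots> = (LINT x|lborel. indicator (box l u) x * H n (x + a n))"
      by (subst integral_distr) (auto simp: add.commute)
    finally show ?thesis ..
  qed
  obtain A where A: "\<And>n. norm (a n) \<le> A" using a by (meson Bseq_def convergentI convergent_imp_Bseq)
  obtain R where R: "\<And>x. x \<in> box l u \<Longrightarrow> norm x \<le> R" using bounded_box[of l u] by (auto simp: bounded_iff)
  have M: "0 \<le> M" using bound[of 0 0] by linarith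
  have frontier: "AE x in lborel. x \<notin> cbox l u - box l u"
    using negligible_frontier_interval[of l u]
    by (intro AE_not_in) (simp add: negligible_iff_null_sets null_sets_completion_iff)
  show ?thesis unfolding shift
  \<comment> \<open>\<open>R\<close> bounds the box and \<open>A\<close> bounds the shifts, so the
    ball of radius \<open>R + A\<close> contains all shifted boxes.\<close>
  proof (rule integral_dominated_convergence[where w = "\<lambda>x. M * indicator (cball 0 (R + A)) x"])
    show "integrable lborel (\<lambda>x::'a. M * indicator (cball 0 (R + A)) x)"
      using emeasure_bounded_finite[OF bounded_cball, of "0::'a" "R + A"]
      by (intro integrable_mult_right integrable_real_indicator) auto
    show "AE x in lborel. (\<lambda>n. indicator (box l u) (x - a n) * H n x) \<longlonglongrightarrow> indicator (box l u) x * h x"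
      using lim frontier
    proof eventually_elim
      case (elim x)
      have x: "(\<lambda>n. x - a n) \<longlonglongrightarrow> x" using tendsto_diff[OF tendsto_const a, of x] by simp
      have "x \<in> box l u \<or> x \<in> - cbox l u" using elim by auto
      then have "\<forall>\<^sub>F n in sequentially. indicator (box l u) x = (indicator (box l u) (x - a n) :: real)"
      proof
        assume "x \<in> box l u"
        with topological_tendstoD[OF x open_box this] show ?thesis by (auto elim!: eventually_mono)
      next
        assume n: "x \<in> - cbox l u"
        have "\<forall>\<^sub>F n in sequentially. x - a n \<in> - cbox l u"
          using topological_tendstoD[OF x _ n] by (simp add: closed_cbox open_Compl)
        then show ?thesis using n box_subset_cbox[of l u] by (auto elim!: eventually_mono simp: indicator_def)
      qed
      then have "(\<lambda>n. indicator (box l u) (x - a n) :: real) \<longlonglongrightarrow> indicator (box l u) x"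
        by (intro tendsto_eventually) (auto elim!: eventually_mono)
      then show ?case using elim by (intro tendsto_mult) auto
    qed
    fix n
    show "AE x in lborel. norm (indicator (box l u) (x - a n) * H n x) \<le> M * indicator (cball 0 (R + A)) x"
    proof (intro AE_I2)
      fix x
      have "norm x \<le> R + A" if "x - a n \<in> box l u"
        using R[OF that] A[of n] norm_triangle_ineq[of "x - a n" "a n"] by simp
      then show "norm (indicator (box l u) (x - a n) * H n x) \<le> M * indicator (cball 0 (R + A)) x"
        using bound[of n x] M by (auto simp: indicator_def)
    qed
  qed auto
qed

text \<open>A limit along the steps 1/(n+1) makes Borel measurability in \<open>x\<close> immediate.
  Where the two-sided directional derivative exists the values agree; elsewhere the value is
  whatever \<open>lim\<close> returns.\<close>

definition dir_deriv :: "('a::euclidean_space \<Rightarrow> real) \<Rightarrow> 'a \<Rightarrow> 'a \<Rightarrow> real" where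
  "dir_deriv f v x = lim (\<lambda>n. (f (x + (1 / real (Suc n)) *\<^sub>R v) - f x) / (1 / real (Suc n)))"

lemma LIMSEQ_dir_deriv:
  assumes "((\<lambda>h. (f (x + h *\<^sub>R v) - f x) / h) \<longlongrightarrow> D) (at 0)"
  shows "(\<lambda>n. (f (x + (1 / real (Suc n)) *\<^sub>R v) - f x) / (1 / real (Suc n))) \<longlonglongrightarrow> D"
proof -
  have "filterlim (\<lambda>n. 1 / real (Suc n)) (at 0) sequentially"
    using LIMSEQ_Suc[OF lim_1_over_n[where 'a=real]] by (auto simp: filterlim_at intro!: always_eventually)
  then show ?thesis by (rule filterlim_compose[OF assms])
qed

lemma dir_deriv_eq:
  assumes "((\<lambda>h. (f (x + h *\<^sub>R v) - f x) / h) \<longlongrightarrow> D) (at 0)"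
  shows "dir_deriv f v x = D"
  unfolding dir_deriv_def using LIMSEQ_dir_deriv[OF assms] by (rule limI)

lemma AE_dir_deriv:
  fixes f :: "'a::euclidean_space \<Rightarrow> real"
  assumes "C-lipschitz_on UNIV f"
  shows "AE x in lborel. ((\<lambda>h. (f (x + h *\<^sub>R v) - f x) / h) \<longlongrightarrow> dir_deriv f v x) (at 0)"
  using AE_directionally_differentiable[OF assms, of v]
  by eventually_elim (auto simp: dir_deriv_eq)

text \<open>The exact splitting of the quotient has a summand at the moved point, so it cannot be
  passed to the limit pointwise. Integrated over boxes it can, and a bounded function with vanishing
  box integrals is zero almost everywhere.\<close>

lemma AE_dir_deriv_add:
  fixes f :: "'a::euclidean_space \<Rightarrow> real"
  assumes lip: "C-lipschitz_on UNIV f"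
  shows "AE x in lborel. dir_deriv f (v + w) x = dir_deriv f v x + dir_deriv f w x"
proof -
  define s where "s v n x = (f (x + (1 / real (Suc n)) *\<^sub>R v) - f x) / (1 / real (Suc n))" for v n x
  define good where "good v x \<longleftrightarrow> (\<lambda>n. s v n x) \<longlonglongrightarrow> dir_deriv f v x" for v x
  have [measurable]: "f \<in> borel_measurable borel"
    using lipschitz_on_continuous_on[OF lip] by (rule borel_measurable_continuous_onI)
  have ms[measurable]: "s v n \<in> borel_measurable borel" for v n unfolding s_def by measurable
  have md[measurable]: "dir_deriv f v \<in> borel_measurable borel" for v
    unfolding dir_deriv_def by measurable
  have [measurable]: "Measurable.pred borel (good v)" for v unfolding good_def by measurable
  have good: "AE x in lborel. good v x" for v
    using AE_dir_deriv[OF lip, of v]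
    by eventually_elim (unfold good_def s_def, rule LIMSEQ_dir_deriv)
  have bound: "\<bar>s v n x\<bar> \<le> C * norm v" for v n x
    unfolding s_def by (rule lipschitz_slope_bound[OF lip])
  have split: "s (v + w) n x = s v n x + s w n (x + (1 / real (Suc n)) *\<^sub>R v)" for n x
    by (simp add: s_def add_divide_distrib[symmetric] algebra_simps)
  have a: "(\<lambda>n. (1 / real (Suc n)) *\<^sub>R v) \<longlonglongrightarrow> 0"
    using tendsto_scaleR[OF LIMSEQ_Suc[OF lim_1_over_n[where 'a=real]] tendsto_const[of v]] by simp
  \<comment> \<open>The defect of additivity, set to 0 where one of the three limits fails; this
    makes it bounded everywhere and changes it only on a null set.\<close>
  define k where "k x = (if good v x \<and> good w x \<and> good (v + w) x
      then dir_deriv f (v + w) x - (dir_deriv f v x + dir_deriv f w x) else 0)" for x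
  have mk[measurable]: "k \<in> borel_measurable borel" unfolding k_def by measurable
  have AEk: "AE x in lborel. k x = dir_deriv f (v + w) x - (dir_deriv f v x + dir_deriv f w x)"
    using good[of v] good[of w] good[of "v + w"] by eventually_elim (simp add: k_def)
  have dbound: "\<bar>dir_deriv f v x\<bar> \<le> C * norm v" if "good v x" for v x
    using that bound unfolding good_def
    by (intro Lim_bounded[of "\<lambda>n. \<bar>s v n x\<bar>" _ 0]) (auto intro: tendsto_rabs)
  have "AE x in lborel. k x = 0"
  proof (rule AE_zero_if_box_integrals_zero[OF mk])
    show "\<bar>k x\<bar> \<le> C * norm (v + w) + (C * norm v + C * norm w)" for x
    proof (cases "good v x \<and> good w x \<and> good (v + w) x")
      case True
      then show ?thesis using dbound[of v x] dbound[of w x] dbound[of "v + w" x]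
        by (simp add: k_def abs_le_iff)
    next
      case False
      then have "k x = 0" unfolding k_def by meson
      then show ?thesis using lipschitz_on_nonneg[OF lip] by simp
    qed
    fix l u :: 'a
    let ?I = "\<lambda>g. LINT x|lborel. indicator (box l u) x * g x"
    have box_int: "integrable lborel (\<lambda>x. indicator (box l u) x * g x)"
      if [measurable]: "g \<in> borel_measurable borel" and b: "AE x in lborel. \<bar>g x\<bar> \<le> K" for g :: "'a \<Rightarrow> real" and K
    proof (rule Bochner_Integration.integrable_bound[where f = "\<lambda>x. K * indicator (box l u) x"])
      show "integrable lborel (\<lambda>x. K * indicator (box l u) x)"
        using emeasure_bounded_finite[OF bounded_box, of l u]
        by (intro integrable_mult_right integrable_real_indicator) auto
      show "AE x in lborel. norm (indicator (box l u) x * g x) \<le> norm (K * indicator (box l u) x)"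
        using b by eventually_elim (auto simp: indicator_def)
    qed measurable
    have ib: "integrable lborel (\<lambda>x. indicator (box l u) x * dir_deriv f v x)" for v
      by (rule box_int[of _ "C * norm v"]) (use good[of v] dbound in \<open>auto elim!: eventually_mono\<close>)
    have L1: "(\<lambda>n. ?I (s (v + w) n)) \<longlonglongrightarrow> ?I (dir_deriv f (v + w))"
      using box_integral_shift_tendsto[OF ms md bound _ tendsto_const, where l = l and u = u]
        good[of "v + w"] by (simp add: good_def)
    have L2: "(\<lambda>n. ?I (s v n)) \<longlonglongrightarrow> ?I (dir_deriv f v)"
      using box_integral_shift_tendsto[OF ms md bound _ tendsto_const, where l = l and u = u]
        good[of v] by (simp add: good_def)
    have L3: "(\<lambda>n. ?I (\<lambda>x. s w n (x + (1 / real (Suc n)) *\<^sub>R v))) \<longlonglongrightarrow> ?I (dir_deriv f w)"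
      using box_integral_shift_tendsto[OF ms md bound _ a, where l = l and u = u] good[of w] by (simp add: good_def)
    have "?I (s (v + w) n) = ?I (s v n) + ?I (\<lambda>x. s w n (x + (1 / real (Suc n)) *\<^sub>R v))" for n
      unfolding split distrib_left
      by (intro Bochner_Integration.integral_add box_int[of _ "C * norm v"] box_int[of _ "C * norm w"] AE_I2 bound) measurable
    then have "(\<lambda>n. ?I (s (v + w) n)) \<longlonglongrightarrow> ?I (dir_deriv f v) + ?I (dir_deriv f w)"
      using tendsto_add[OF L2 L3] by simp
    then have eq: "?I (dir_deriv f (v + w)) = ?I (dir_deriv f v) + ?I (dir_deriv f w)"
      using L1 LIMSEQ_unique by blast
    have "?I k = ?I (\<lambda>x. dir_deriv f (v + w) x - (dir_deriv f v x + dir_deriv f w x))"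
      using AEk by (intro integral_cong_AE) (auto elim!: eventually_mono)
    also have "\<dots> = 0"
      using eq by (simp add: right_diff_distrib distrib_left ib)
    finally show "?I k = 0" .
  qed
  with AEk show ?thesis by eventually_elim simp
qed

text \<open>Homogeneity comes from the substitution of c h for h, additivity from the previous
  result, and \<open>v\<close> is expanded in the basis. The exceptional null set depends on
  \<open>v\<close>.\<close>

lemma AE_dir_deriv_linear:
  fixes f :: "'a::euclidean_space \<Rightarrow> real"
  assumes lip: "C-lipschitz_on UNIV f"
  shows "AE x in lborel. dir_deriv f v x = (\<Sum>b\<in>Basis. dir_deriv f b x *\<^sub>R b) \<bullet> v"
proof -
  have scale: "AE x in lborel. dir_deriv f (c *\<^sub>R b) x = c * dir_deriv f b x" for c b
    using AE_dir_deriv[OF lip, of b]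
  proof eventually_elim
    case (elim x)
    show ?case
    proof (cases "c = 0")
      case False
      have "filterlim (\<lambda>h. c * h) (at 0) (at 0)"
        using False by (auto simp: filterlim_at eventually_at intro!: tendsto_eq_intros exI[of _ 1])
      from filterlim_compose[OF elim this]
      have "((\<lambda>h. c * ((f (x + (c * h) *\<^sub>R b) - f x) / (c * h))) \<longlongrightarrow> c * dir_deriv f b x) (at 0)"
        by (rule tendsto_mult_left)
      then have "((\<lambda>h. (f (x + h *\<^sub>R (c *\<^sub>R b)) - f x) / h) \<longlongrightarrow> c * dir_deriv f b x) (at 0)"
        using False by (simp add: mult.commute)
      then show ?thesis by (rule dir_deriv_eq)
    qed (use dir_deriv_eq[of f x 0 0] in simp)
  qed
  have "AE x in lborel. dir_deriv f (\<Sum>b\<in>B. (v \<bullet> b) *\<^sub>R b) x = (\<Sum>b\<in>B. (v \<bullet> b) * dir_deriv f b x)"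
    if "finite B" for B
    using that
  proof (induction B rule: finite_induct)
    case empty
    show ?case by (intro AE_I2) (use dir_deriv_eq[of f _ 0 0] in simp)
  next
    case (insert b B)
    show ?case
      using insert.IH scale[of "v \<bullet> b" b] AE_dir_deriv_add[OF lip, of "(v \<bullet> b) *\<^sub>R b" "\<Sum>b\<in>B. (v \<bullet> b) *\<^sub>R b"]
      by eventually_elim (use insert.hyps in simp)
  qed
  from this[OF finite_Basis] show ?thesis
    unfolding euclidean_representation
    by eventually_elim (simp add: inner_sum_right inner_commute[of _ v] mult.commute)
qed

section \<open>From directional derivatives to differentiability\<close>

text \<open>The sphere is compact, so up to a given error finitely many of the directions suffice.\<close>

lemma has_derivative_if_dense_directions:
  fixes f :: "'a::euclidean_space \<Rightarrow> real"
  assumes lip: "C-lipschitz_on UNIV f"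
    and dense: "\<And>V. open V \<Longrightarrow> V \<noteq> {} \<Longrightarrow> \<exists>v\<in>D. v \<in> V"
    and dir: "\<And>v. v \<in> D \<Longrightarrow> ((\<lambda>h. (f (x + h *\<^sub>R v) - f x) / h) \<longlongrightarrow> a \<bullet> v) (at 0)"
  shows "(f has_derivative (\<lambda>v. a \<bullet> v)) (at x)"
  unfolding has_derivative_within_alt
proof (intro conjI allI impI)
  show "bounded_linear ((\<bullet>) a)" by (rule bounded_linear_inner_right)
  fix e :: real assume "e > 0"
  have C: "0 \<le> C" by (rule lipschitz_on_nonneg[OF lip])
  \<comment> \<open>Replacing the direction \<open>w\<close> by a nearby \<open>v\<close> costs C
    \<epsilon> in \<open>f\<close> and |a| \<epsilon> in the linear part, and the quotient along
    \<open>v\<close> is off by \<epsilon>. The three errors add up to \<open>e\<close>.\<close>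
  define \<epsilon> where "\<epsilon> = e / (C + 1 + norm a)"
  have den: "0 < C + 1 + norm a" using C by (simp add: add_nonneg_pos add_pos_nonneg)
  have "\<epsilon> > 0" using \<open>e > 0\<close> den by (simp add: \<epsilon>_def)
  have "sphere 0 1 \<subseteq> (\<Union>v\<in>D. ball v \<epsilon>)"
  proof
    fix w :: 'a
    have "\<exists>v\<in>D. v \<in> ball w \<epsilon>" using \<open>\<epsilon> > 0\<close> by (intro dense) auto
    then show "w \<in> (\<Union>v\<in>D. ball v \<epsilon>)" by (auto simp: dist_commute)
  qed
  then obtain S where S: "S \<subseteq> D" "finite S" "sphere 0 1 \<subseteq> (\<Union>v\<in>S. ball v \<epsilon>)"
    using compactE_image[OF compact_sphere, of D "\<lambda>v. ball v \<epsilon>"] by (metis open_ball)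
  have "\<forall>\<^sub>F h in at 0. \<forall>v\<in>S. \<bar>(f (x + h *\<^sub>R v) - f x) / h - a \<bullet> v\<bar> < \<epsilon>"
    using S \<open>\<epsilon> > 0\<close> dir by (subst eventually_ball_finite_distrib) (auto simp: tendsto_iff dist_real_def)
  then obtain d where d: "d > 0"
    and close: "\<And>h v. h \<noteq> 0 \<Longrightarrow> \<bar>h\<bar> < d \<Longrightarrow> v \<in> S \<Longrightarrow> \<bar>(f (x + h *\<^sub>R v) - f x) / h - a \<bullet> v\<bar> < \<epsilon>"
    by (auto simp: eventually_at dist_real_def)
  show "\<exists>d>0. \<forall>y\<in>UNIV. norm (y - x) < d \<longrightarrow> norm (f y - f x - a \<bullet> (y - x)) \<le> e * norm (y - x)"
  proof (intro exI[of _ d] conjI ballI impI d)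
    fix y assume y: "norm (y - x) < d"
    show "norm (f y - f x - a \<bullet> (y - x)) \<le> e * norm (y - x)"
    proof (cases "y = x")
      case False
      define h where "h = norm (y - x)"
      define w where "w = (1 / h) *\<^sub>R (y - x)"
      have h: "h > 0" "h < d" using False y by (auto simp: h_def)
      have w: "norm w = 1" "y - x = h *\<^sub>R w" using h by (auto simp: w_def h_def)
      then obtain v where v: "v \<in> S" "norm (w - v) < \<epsilon>"
        using S(3) by (force simp: dist_norm norm_minus_commute)
      have y_eq: "y = x + h *\<^sub>R w" using w(2) by (simp add: algebra_simps)
      have "\<bar>f y - f (x + h *\<^sub>R v)\<bar> \<le> C * norm (h *\<^sub>R w - h *\<^sub>R v)"
        using lipschitz_onD[OF lip, of y "x + h *\<^sub>R v"] by (simp add: dist_norm y_eq)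
      also have "h *\<^sub>R w - h *\<^sub>R v = h *\<^sub>R (w - v)" by (simp add: scaleR_diff_right)
      also have "C * norm (h *\<^sub>R (w - v)) \<le> C * (h * \<epsilon>)"
        using C v h by (intro mult_left_mono) auto
      finally have 1: "\<bar>f y - f (x + h *\<^sub>R v)\<bar> \<le> C * (h * \<epsilon>)" .
      have "\<bar>f (x + h *\<^sub>R v) - f x - h * (a \<bullet> v)\<bar> = h * \<bar>(f (x + h *\<^sub>R v) - f x) / h - a \<bullet> v\<bar>"
        using h by (simp add: abs_mult_pos' field_simps flip: abs_mult_pos)
      also have "\<dots> \<le> h * \<epsilon>" using close[of h v] h v by (intro mult_left_mono) auto
      finally have 2: "\<bar>f (x + h *\<^sub>R v) - f x - h * (a \<bullet> v)\<bar> \<le> h * \<epsilon>" .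
      have "\<bar>h * (a \<bullet> v) - h * (a \<bullet> w)\<bar> = h * \<bar>a \<bullet> (w - v)\<bar>"
        using h by (simp add: inner_diff_right abs_mult abs_minus_commute flip: right_diff_distrib)
      also have "\<dots> \<le> h * (norm a * \<epsilon>)"
        using h v by (intro mult_left_mono order_trans[OF Cauchy_Schwarz_ineq2]) auto
      finally have 3: "\<bar>h * (a \<bullet> v) - h * (a \<bullet> w)\<bar> \<le> h * (norm a * \<epsilon>)" .
      have "\<bar>f y - f x - h * (a \<bullet> w)\<bar> \<le> C * (h * \<epsilon>) + h * \<epsilon> + h * (norm a * \<epsilon>)"
        using 1 2 3 by (simp add: abs_le_iff)
      also have "\<dots> = ((C + 1 + norm a) * \<epsilon>) * h" by (simp add: algebra_simps)
      also have "\<dots> = e * h" using den by (simp add: \<epsilon>_def)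
      finally show ?thesis using w(1) h(1) by (simp add: w(2))
    qed simp
  qed
qed

text \<open>Existence and linearity of the directional derivative hold outside one null set for all
  directions of a countable dense set, and these directions determine differentiability.\<close>

theorem Rademacher_real:
  fixes f :: "'a::euclidean_space \<Rightarrow> real"
  assumes lip: "C-lipschitz_on UNIV f"
  shows "AE x in lborel. f differentiable (at x)"
proof -
  obtain D :: "'a set" where D: "countable D" "\<And>V. open V \<Longrightarrow> V \<noteq> {} \<Longrightarrow> \<exists>v\<in>D. v \<in> V"
    using countable_dense_exists by blast
  have "AE x in lborel. \<forall>v\<in>D. ((\<lambda>h. (f (x + h *\<^sub>R v) - f x) / h) \<longlongrightarrow> dir_deriv f v x) (at 0)"
    using AE_dir_deriv[OF lip] by (simp add: AE_ball_countable D(1))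
  moreover have "AE x in lborel. \<forall>v\<in>D. dir_deriv f v x = (\<Sum>b\<in>Basis. dir_deriv f b x *\<^sub>R b) \<bullet> v"
    using AE_dir_deriv_linear[OF lip] by (simp add: AE_ball_countable D(1))
  ultimately show ?thesis
  proof eventually_elim
    case (elim x)
    then show ?case
      using has_derivative_if_dense_directions[OF lip D(2), of x "\<Sum>b\<in>Basis. dir_deriv f b x *\<^sub>R b"]
      by (auto intro: differentiableI)
  qed
qed

text \<open>Composition with the nearest-point projection onto a closed ball in \<open>U\<close>
  extends \<open>f\<close> to a globally Lipschitz function without changing it on the ball;
  Rademacher's theorem is then applied to each coordinate.\<close>

corollary Rademacher_dense:
  fixes f :: "'a::euclidean_space \<Rightarrow> 'b::euclidean_space"
  assumes U: "open U" "u \<in> U" and lip: "C-lipschitz_on U f" and "e > 0"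
  obtains x where "x \<in> U" "dist x u < e" "f differentiable (at x)"
proof -
  obtain r where r: "r > 0" "cball u r \<subseteq> U" using U open_contains_cball by blast
  define g where "g = f \<circ> closest_point (cball u r)"
  have in_ball: "closest_point (cball u r) x \<in> cball u r" for x
    using r by (intro closest_point_in_set) auto
  have glip: "C-lipschitz_on UNIV g"
  proof (rule lipschitz_onI)
    show "dist (g x) (g y) \<le> C * dist x y" for x y
    proof -
      have "dist (g x) (g y) \<le> C * dist (closest_point (cball u r) x) (closest_point (cball u r) y)"
        unfolding g_def comp_def using in_ball r by (intro lipschitz_onD[OF lip]) auto
      also have "\<dots> \<le> C * dist x y"
        using r lipschitz_on_nonneg[OF lip]
        by (intro mult_left_mono closest_point_lipschitz) auto
      finally show ?thesis .
    qed
  qed (rule lipschitz_on_nonneg[OF lip])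
  have "AE x in lborel. \<forall>b\<in>Basis. (\<lambda>x. g x \<bullet> b) differentiable (at x)"
  proof (subst AE_ball_countable)
    show "\<forall>b\<in>Basis. AE x in lborel. (\<lambda>x. g x \<bullet> b) differentiable (at x)"
    proof
      fix b :: 'b assume b: "b \<in> Basis"
      have "C-lipschitz_on UNIV (\<lambda>x. g x \<bullet> b)"
      proof (rule lipschitz_onI)
        show "dist (g x \<bullet> b) (g y \<bullet> b) \<le> C * dist x y" for x y
          using order_trans[OF Basis_le_norm[OF b, of "g x - g y"]] lipschitz_onD[OF glip, of x y]
          by (simp add: dist_norm inner_diff_left)
      qed (rule lipschitz_on_nonneg[OF lip])
      then show "AE x in lborel. (\<lambda>x. g x \<bullet> b) differentiable (at x)" by (rule Rademacher_real)
    qed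
  qed (simp add: countable_finite)
  then obtain N where N: "N \<in> null_sets lborel" "{x. \<not> g differentiable (at x)} \<subseteq> N"
    by (auto simp: eventually_ae_filter differentiable_componentwise_within[of g])
  \<comment> \<open>A nonempty open ball is not negligible, so it contains points outside the
    exceptional null set. The radius \<open>min e r\<close> keeps them in the region where the
    extension agrees with \<open>f\<close>.\<close>
  have "\<not> ball u (min e r) \<subseteq> N"
  proof
    assume "ball u (min e r) \<subseteq> N"
    then have "negligible (ball u (min e r))"
      using N(1) by (meson negligible_iff_null_sets negligible_subset null_sets_completionI)
    then show False using \<open>e > 0\<close> r(1) open_not_negligible[of "ball u (min e r)"] by (simp add: ball_eq_empty)
  qed
  then obtain x where x: "x \<in> ball u (min e r)" "g differentiable (at x)" using N(2) by blast
  have "f differentiable (at x)"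
  proof (rule differentiable_transform_within[OF x(2)])
    show "0 < r - dist u x" using x(1) by simp
    show "g y = f y" if "dist y x < r - dist u x" for y
    proof -
      have "dist u y \<le> r" using that dist_triangle[of u y x] by (simp add: dist_commute)
      then show ?thesis by (simp add: g_def closest_point_self)
    qed
  qed simp
  moreover have "x \<in> U" "dist x u < e" using x(1) r(2) by (auto simp: dist_commute)
  ultimately show ?thesis using that by blast
qed

section \<open>Tangent cones of graphs\<close>

text \<open>The definition asks for membership at every index, so the finitely many initial terms
  that may lie outside \<open>W\<close> are cut off by an index shift.\<close>

lemma tangent_cone_local:
  fixes z :: "'a::real_normed_vector"
  assumes W: "open W" "z \<in> W"
  shows "tangent_cone (A \<inter> W) z = tangent_cone A z"
proof
  show "tangent_cone (A \<inter> W) z \<subseteq> tangent_cone A z" unfolding tangent_cone_def by blast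
  show "tangent_cone A z \<subseteq> tangent_cone (A \<inter> W) z"
  proof
    fix w assume "w \<in> tangent_cone A z"
    then obtain t :: "nat \<Rightarrow> real" and v where t: "\<And>k. t k > 0" "t \<longlonglongrightarrow> 0" and v: "v \<longlonglongrightarrow> w"
      and A: "\<And>k. z + t k *\<^sub>R v k \<in> A"
      unfolding tangent_cone_def by blast
    have "(\<lambda>k. z + t k *\<^sub>R v k) \<longlonglongrightarrow> z" using tendsto_add[OF tendsto_const tendsto_scaleR[OF t(2) v], of z] by simp
    from topological_tendstoD[OF this W] obtain N where N: "\<And>k. k \<ge> N \<Longrightarrow> z + t k *\<^sub>R v k \<in> W"
      by (auto simp: eventually_sequentially)
    show "w \<in> tangent_cone (A \<inter> W) z" unfolding tangent_cone_def
      using t(1) A N LIMSEQ_ignore_initial_segment[OF t(2), of N] LIMSEQ_ignore_initial_segment[OF v, of N]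
      by (intro CollectI exI[of _ "\<lambda>k. t (k + N)"] exI[of _ "\<lambda>k. v (k + N)"] conjI allI) simp_all
  qed
qed

lemma tangent_cone_open:
  fixes z :: "'a::real_normed_vector"
  assumes "open W" "z \<in> W"
  shows "tangent_cone W z = UNIV"
proof -
  have "w \<in> tangent_cone UNIV z" for w :: 'a
    unfolding tangent_cone_def
    using LIMSEQ_inverse_real_of_nat by (intro CollectI exI[of _ "\<lambda>k. inverse (real (Suc k))"] exI[of _ "\<lambda>k. w"] conjI allI) simp_all
  then show ?thesis using tangent_cone_local[OF assms, of UNIV] by auto
qed

text \<open>Only one inclusion, but for a diffeomorphism it yields equality when applied to the
  inverse as well.\<close>

lemma tangent_cone_image:
  fixes g :: "'a::real_normed_vector \<Rightarrow> 'b::real_normed_vector"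
  assumes g: "(g has_derivative g') (at z)" and w: "w \<in> tangent_cone A z"
  shows "g' w \<in> tangent_cone (g ` A) (g z)"
proof -
  from w obtain t :: "nat \<Rightarrow> real" and v where t: "\<And>k. t k > 0" "t \<longlonglongrightarrow> 0" and v: "v \<longlonglongrightarrow> w"
    and A: "\<And>k. z + t k *\<^sub>R v k \<in> A"
    unfolding tangent_cone_def by blast
  \<comment> \<open>The directions that lead from \<open>g z\<close> to the image points. They
    differ from \<open>g' (v k)\<close> by a null sequence, since \<open>v\<close> is bounded and
    the remainder of \<open>g\<close> is of smaller order than \<open>t k\<close>.\<close>
  define v' where "v' k = (1 / t k) *\<^sub>R (g (z + t k *\<^sub>R v k) - g z)" for k
  have lin: "bounded_linear g'" using g by (rule has_derivative_bounded_linear)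
  have step: "(\<lambda>k. t k *\<^sub>R v k) \<longlonglongrightarrow> 0" using tendsto_scaleR[OF t(2) v] by simp
  have "(\<lambda>k. v' k - g' (v k)) \<longlonglongrightarrow> 0"
  proof (rule tendstoI)
    fix e :: real assume "e > 0"
    obtain K where K: "K > 0" "\<And>k. norm (v k) \<le> K"
      using v by (meson BseqE convergentI convergent_imp_Bseq)
    have "e / (2 * K) > 0" using \<open>e > 0\<close> K by simp
    then obtain d where d: "d > 0"
      and small: "\<And>y. norm (y - z) < d \<Longrightarrow> norm (g y - g z - g' (y - z)) \<le> e / (2 * K) * norm (y - z)"
      using g unfolding has_derivative_within_alt by blast
    show "\<forall>\<^sub>F k in sequentially. dist (v' k - g' (v k)) 0 < e"
      using tendstoD[OF step d]
    proof eventually_elim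
      case (elim k)
      have "v' k - g' (v k) = (1 / t k) *\<^sub>R (g (z + t k *\<^sub>R v k) - g z - g' (t k *\<^sub>R v k))"
        using t(1)[of k] lin by (simp add: v'_def scaleR_diff_right linear_simps(5))
      then have "norm (v' k - g' (v k)) = norm (g (z + t k *\<^sub>R v k) - g z - g' (t k *\<^sub>R v k)) / t k"
        using t(1)[of k] by simp
      also have "\<dots> \<le> (e / (2 * K) * norm (t k *\<^sub>R v k)) / t k"
        using small[of "z + t k *\<^sub>R v k"] elim t(1)[of k] by (intro divide_right_mono) auto
      also have "\<dots> = e / (2 * K) * norm (v k)" using t(1)[of k] by simp
      also have "\<dots> \<le> e / (2 * K) * K" using K \<open>e > 0\<close> by (intro mult_left_mono) auto
      also have "\<dots> < e" using K \<open>e > 0\<close> by simp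
      finally show ?case by simp
    qed
  qed
  from tendsto_add[OF this bounded_linear.tendsto[OF lin v]] have "v' \<longlonglongrightarrow> g' w" by simp
  moreover have "g z + t k *\<^sub>R v' k \<in> g ` A" for k using A[of k] t(1)[of k] by (simp add: v'_def)
  ultimately show ?thesis unfolding tangent_cone_def using t by blast
qed


lemma tangent_cone_singleton: "tangent_cone {z} z = {0}" for z :: "'a::real_normed_vector"
proof
  show "tangent_cone {z} z \<subseteq> {0}"
  proof
    fix w assume "w \<in> tangent_cone {z} z"
    then obtain t :: "nat \<Rightarrow> real" and v where t: "\<And>k. t k > 0" and v: "v \<longlonglongrightarrow> w"
      and A: "\<And>k. z + t k *\<^sub>R v k \<in> {z}"
      unfolding tangent_cone_def by blast
    have "v k = 0" for k using t[of k] A[of k] by simp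
    then have "v = (\<lambda>k. 0)" by (rule ext)
    then show "w \<in> {0}" using v LIMSEQ_unique[OF tendsto_const] by blast
  qed
  show "{0} \<subseteq> tangent_cone {z} z"
    unfolding tangent_cone_def using LIMSEQ_inverse_real_of_nat
    by (intro subsetI CollectI exI[of _ "\<lambda>k. inverse (real (Suc k))"] exI[of _ "\<lambda>k. 0"] conjI allI) simp_all
qed

lemma graph_as_image: "gph (single_valued U f) = (\<lambda>x. (x, f x)) ` U"
  by (auto simp: gph_def single_valued_def split: if_splits)

text \<open>Both inclusions are images of tangent cones: the graph is the image of \<open>U\<close>
  under x \<mapsto> (x, f x), and (x, y) \<mapsto> y - f x collapses it to a point, whose tangent
  cone is trivial, so the derivative of that map vanishes on tangent vectors.\<close>

lemma tangent_cone_graph: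
  fixes f :: "real^'n \<Rightarrow> real^'n"
  assumes U: "open U" "u \<in> U" and f: "(f has_derivative f') (at u)"
  shows "tangent_cone (gph (single_valued U f)) (u, f u) = range (\<lambda>h. (h, f' h))"
proof
  have "((\<lambda>x. (x, f x)) has_derivative (\<lambda>h. (h, f' h))) (at u)"
    by (intro derivative_intros f)
  from tangent_cone_image[OF this, of _ U]
  show "range (\<lambda>h. (h, f' h)) \<subseteq> tangent_cone (gph (single_valued U f)) (u, f u)"
    unfolding graph_as_image tangent_cone_open[OF U] by blast
  have "((\<lambda>z. snd z - f (fst z)) has_derivative (\<lambda>w. snd w - f' (fst w))) (at (u, f u))"
    using has_derivative_compose[OF has_derivative_fst[OF has_derivative_ident], of f f' "(u, f u)" UNIV] f
    by (intro has_derivative_diff has_derivative_snd has_derivative_ident) simp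
  note snd_minus = tangent_cone_image[OF this, of _ "gph (single_valued U f)"]
  have "(\<lambda>z. snd z - f (fst z)) ` gph (single_valued U f) = {0}"
    unfolding graph_as_image image_image using U(2) by auto
  then have "snd w - f' (fst w) = 0" if "w \<in> tangent_cone (gph (single_valued U f)) (u, f u)" for w
    using snd_minus[OF that] by (simp add: tangent_cone_singleton)
  then show "tangent_cone (gph (single_valued U f)) (u, f u) \<subseteq> range (\<lambda>h. (h, f' h))"
    by (auto simp: image_iff)
qed

lemma tangent_cone_graph_lipschitz:
  fixes f :: "real^'n \<Rightarrow> real^'n"
  assumes lip: "C-lipschitz_on U f" and u: "u \<in> U"
    and w: "w \<in> tangent_cone (gph (single_valued U f)) (u, f u)"
  shows "norm (snd w) \<le> C * norm (fst w)"
proof -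
  from w obtain t :: "nat \<Rightarrow> real" and v where t: "\<And>k. t k > 0" and v: "v \<longlonglongrightarrow> w"
    and A: "\<And>k. (u, f u) + t k *\<^sub>R v k \<in> gph (single_valued U f)"
    unfolding tangent_cone_def by blast
  have "norm (snd (v k)) \<le> C * norm (fst (v k))" for k
  proof -
    have "u + t k *\<^sub>R fst (v k) \<in> U" and eq: "f u + t k *\<^sub>R snd (v k) = f (u + t k *\<^sub>R fst (v k))"
      using A[of k] by (auto simp: graph_as_image prod_eq_iff)
    then have "norm (t k *\<^sub>R snd (v k)) \<le> C * norm (t k *\<^sub>R fst (v k))"
      using lipschitz_onD[OF lip, of "u + t k *\<^sub>R fst (v k)" u] u by (simp add: dist_norm flip: eq)
    then show ?thesis using t[of k] by simp
  qed
  moreover have "(\<lambda>k. norm (snd (v k))) \<longlonglongrightarrow> norm (snd w)" "(\<lambda>k. C * norm (fst (v k))) \<longlonglongrightarrow> C * norm (fst w)"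
    by (intro tendsto_intros v)+
  ultimately show ?thesis by (meson LIMSEQ_le)
qed

text \<open>By the Lipschitz bound a tangent vector with zero first part vanishes. Hence an
  n-dimensional tangent space projects bijectively onto the first factor and is the graph of a
  linear map \<open>A\<close>. Compactness of the difference quotients shows that \<open>A\<close>
  is the derivative.\<close>

lemma differentiable_if_tangent_cone_half_dim:
  fixes f :: "real^'n \<Rightarrow> real^'n"
  assumes U: "open U" "u \<in> U" and lip: "C-lipschitz_on U f"
    and T: "tangent_cone (gph (single_valued U f)) (u, f u) \<in> half_dim_subspaces"
  shows "f differentiable (at u)"
proof -
  define L where "L = tangent_cone (gph (single_valued U f)) (u, f u)"
  have L: "subspace L" "dim L = CARD('n)" using T by (auto simp: half_dim_subspaces_def L_def)
  have bound: "norm (snd w) \<le> C * norm (fst w)" if "w \<in> L" for w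
    using tangent_cone_graph_lipschitz[OF lip U(2)] that by (simp add: L_def)
  have inj: "inj_on fst L"
  proof (rule inj_onI)
    fix w w' assume w: "w \<in> L" "w' \<in> L" "fst w = fst w'"
    then have "norm (snd (w - w')) \<le> C * norm (fst (w - w'))" using L(1) by (intro bound subspace_diff)
    then show "w = w'" using w by (simp add: prod_eq_iff)
  qed
  have "dim (fst ` L) = CARD('n)"
    using dim_image_eq[of fst L] inj L by (simp add: linear_fst span_eq_iff[THEN iffD2])
  moreover have "subspace (fst ` L)" using L(1) by (intro linear_subspace_image linear_fst)
  ultimately have surj: "fst ` L = UNIV" using dim_eq_full[of "fst ` L"] by (simp add: span_eq_iff[THEN iffD2])
  define A where "A h = snd (the_inv_into L fst h)" for h
  have inv: "(h, A h) \<in> L" for h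
    using the_inv_into_into[OF inj, of h L] f_the_inv_into_f[OF inj, of h] surj
    by (metis A_def order_refl prod.collapse UNIV_I)
  have A_eq: "snd w = A (fst w)" if "w \<in> L" for w
    using inj_onD[OF inj, of w "(fst w, A (fst w))"] that inv by (metis fst_conv snd_conv)
  have linA: "linear A"
  proof (rule linearI)
    show "A (x + y) = A x + A y" for x y
      using A_eq[OF subspace_add[OF L(1) inv[of x] inv[of y]]] by simp
    show "A (c *\<^sub>R x) = c *\<^sub>R A x" for c x
      using A_eq[OF subspace_scale[OF L(1) inv[of x], of c]] by simp
  qed
  have "(f has_derivative A) (at u)"
    unfolding has_derivative_within_alt
  proof (intro conjI allI impI)
    show "bounded_linear A" using linA by (simp add: linear_conv_bounded_linear)
    fix e :: real assume "e > 0"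
    show "\<exists>d>0. \<forall>y\<in>UNIV. norm (y - u) < d \<longrightarrow> norm (f y - f u - A (y - u)) \<le> e * norm (y - u)"
    proof (rule ccontr)
      assume no: "\<not> (\<exists>d>0. \<forall>y\<in>UNIV. norm (y - u) < d \<longrightarrow> norm (f y - f u - A (y - u)) \<le> e * norm (y - u))"
      \<comment> \<open>The violating points are taken within min r (1/(k+1)) of \<open>u\<close>,
        so that they lie in \<open>U\<close> and tend to \<open>u\<close>.\<close>
      obtain r where r: "r > 0" "ball u r \<subseteq> U" using U openE by blast
      have "\<exists>y. norm (y - u) < min r (inverse (real (Suc k))) \<and> norm (f y - f u - A (y - u)) > e * norm (y - u)" for k
      proof -
        have "min r (inverse (real (Suc k))) > 0" using r by simp
        then show ?thesis using no by (meson not_le)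
      qed
      then obtain y where y: "\<And>k. norm (y k - u) < min r (inverse (real (Suc k)))"
        "\<And>k. norm (f (y k) - f u - A (y k - u)) > e * norm (y k - u)" by metis
      define t where "t k = norm (y k - u)" for k
      \<comment> \<open>Normalized secants: bounded by 1 + C, so a subsequence converges to a
        tangent vector \<open>l\<close>. It lies on the graph of \<open>A\<close>, while the
        violated estimate keeps the secants at distance at least \<open>e\<close> from it.\<close>
      define w where "w k = (1 / t k) *\<^sub>R (y k - u, f (y k) - f u)" for k
      have yU: "y k \<in> U" for k using y(1)[of k] r by (auto simp: dist_norm norm_minus_commute subset_eq)
      have t0: "t k > 0" for k
      proof -
        have "y k \<noteq> u" using y(2)[of k] linear_0[OF linA] by auto
        then show ?thesis by (simp add: t_def)
      qed
      have t: "t \<longlonglongrightarrow> 0"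
      proof (rule tendsto_sandwich[OF _ _ tendsto_const LIMSEQ_inverse_real_of_nat])
        show "\<forall>\<^sub>F k in sequentially. 0 \<le> t k" by (simp add: t_def)
        show "\<forall>\<^sub>F k in sequentially. t k \<le> inverse (real (Suc k))"
          using y(1) by (intro always_eventually allI) (simp add: t_def less_imp_le)
      qed
      have fstw: "norm (fst (w k)) = 1" for k using t0[of k] by (simp add: w_def) (simp add: t_def)
      have "norm (snd (w k)) \<le> C" for k
        using lipschitz_onD[OF lip yU U(2), of k] t0[of k]
        by (simp add: w_def dist_norm divide_le_eq) (simp add: t_def)
      then have "norm (w k) \<le> 1 + C" for k
        using norm_Pair_le[of "fst (w k)" "snd (w k)"] fstw[of k] by (smt (verit) prod.collapse)
      then have "bounded (range w)" unfolding bounded_iff by blast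
      then obtain l s where s: "strict_mono s" "(w \<circ> s) \<longlonglongrightarrow> l"
        using bounded_imp_convergent_subsequence by blast
      have "(t \<circ> s) \<longlonglongrightarrow> 0" using t s(1) by (rule LIMSEQ_subseq_LIMSEQ)
      moreover have "(u, f u) + (t \<circ> s) k *\<^sub>R (w \<circ> s) k \<in> gph (single_valued U f)" for k
        using t0[of "s k"] yU[of "s k"] by (simp add: w_def graph_as_image)
      ultimately have "l \<in> L" unfolding L_def tangent_cone_def using s(2) t0
        by (intro CollectI exI[of _ "t \<circ> s"] exI[of _ "w \<circ> s"] conjI allI) simp_all
      then have l: "snd l = A (fst l)" by (rule A_eq)
      have "e \<le> norm (snd (w k) - A (fst (w k)))" for k
      proof -
        have "snd (w k) - A (fst (w k)) = (1 / t k) *\<^sub>R (f (y k) - f u - A (y k - u))"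
          by (simp add: w_def linear_scale[OF linA] flip: scaleR_diff_right)
        then show ?thesis using y(2)[of k] t0[of k] by (simp add: pos_le_divide_eq) (simp add: t_def)
      qed
      moreover have "(\<lambda>k. norm (snd ((w \<circ> s) k) - A (fst ((w \<circ> s) k)))) \<longlonglongrightarrow> norm (snd l - A (fst l))"
        using linA by (intro tendsto_intros s(2) bounded_linear.tendsto[of A]) (auto simp: linear_conv_bounded_linear)
      ultimately have "e \<le> norm (snd l - A (fst l))"
        by (intro LIMSEQ_le_const) auto
      then show False using \<open>e > 0\<close> l by simp
    qed
  qed
  then show ?thesis by (rule differentiableI)
qed

section \<open>The metric on subspaces\<close>

text \<open>Justifies the definite description in \<open>orth_proj\<close>: existence by orthogonal
  decomposition, uniqueness because the difference of two candidates is orthogonal to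
  itself.\<close>

lemma orth_proj_props:
  fixes L :: "'a::euclidean_space set"
  assumes L: "subspace L"
  shows orth_proj_mem: "orth_proj L z \<in> L"
    and orth_proj_diff: "z - orth_proj L z \<in> orthogonal_comp L"
    and orth_proj_eqI: "\<And>p. p \<in> L \<Longrightarrow> z - p \<in> orthogonal_comp L \<Longrightarrow> orth_proj L z = p"
proof -
  have uniq: "p = q" if "p \<in> L" "q \<in> L" "z - p \<in> orthogonal_comp L" "z - q \<in> orthogonal_comp L" for p q
  proof -
    have "p - q \<in> L" using that L by (intro subspace_diff)
    moreover have "p - q \<in> orthogonal_comp L"
      using subspace_diff[OF subspace_orthogonal_comp that(4,3)] by simp
    ultimately have "(p - q) \<bullet> (p - q) = 0" unfolding orthogonal_comp_def orthogonal_def by blast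
    then show ?thesis by simp
  qed
  obtain y w where "y \<in> span L" "\<And>x. x \<in> span L \<Longrightarrow> orthogonal w x" "z = y + w"
    using orthogonal_subspace_decomp_exists by metis
  then have y: "y \<in> L" "z - y \<in> orthogonal_comp L"
    using L by (auto simp: span_eq_iff[THEN iffD2] orthogonal_comp_def orthogonal_commute)
  have "\<exists>!p. p \<in> L \<and> z - p \<in> orthogonal_comp L" using y uniq by blast
  from theI'[OF this] show 1: "orth_proj L z \<in> L" "z - orth_proj L z \<in> orthogonal_comp L"
    unfolding orth_proj_def by auto
  show "orth_proj L z = p" if "p \<in> L" "z - p \<in> orthogonal_comp L" for p
    using uniq[OF 1(1) that(1) 1(2) that(2)] .
qed

lemma inner_orth_proj_diff:
  assumes "subspace L" "w \<in> L"
  shows "w \<bullet> (z - orth_proj L z) = 0"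
  using orth_proj_diff[OF assms(1), of z] assms(2) by (simp add: orthogonal_comp_def orthogonal_def)

lemma orth_proj_ident: "subspace L \<Longrightarrow> z \<in> L \<Longrightarrow> orth_proj L z = z"
  by (rule orth_proj_eqI) (auto simp: subspace_0 subspace_orthogonal_comp)

lemma linear_orth_proj: "subspace L \<Longrightarrow> linear (orth_proj L)"
proof (rule linearI)
  assume L: "subspace L"
  note c = subspace_orthogonal_comp[of L]
  show "orth_proj L (x + y) = orth_proj L x + orth_proj L y" for x y
    using subspace_add[OF c orth_proj_diff[OF L, of x] orth_proj_diff[OF L, of y]]
    by (intro orth_proj_eqI[OF L] subspace_add[OF L] orth_proj_mem[OF L]) (simp add: algebra_simps)
  show "orth_proj L (a *\<^sub>R x) = a *\<^sub>R orth_proj L x" for a x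
    using subspace_scale[OF c orth_proj_diff[OF L, of x], of a]
    by (intro orth_proj_eqI[OF L] subspace_scale[OF L] orth_proj_mem[OF L]) (simp add: algebra_simps)
qed

lemma bounded_linear_orth_proj_diff:
  fixes L1 L2 :: "'a::euclidean_space set"
  assumes "subspace L1" "subspace L2"
  shows "bounded_linear (\<lambda>z. orth_proj L1 z - orth_proj L2 z)"
  using assms by (simp add: linear_orth_proj linear_compose_sub flip: linear_conv_bounded_linear)

lemma orth_proj_nearest:
  fixes L :: "'a::euclidean_space set"
  assumes L: "subspace L" and y: "y \<in> L"
  shows "norm (z - orth_proj L z) \<le> norm (z - y)"
proof -
  have "orthogonal (z - orth_proj L z) (orth_proj L z - y)"
    using inner_orth_proj_diff[OF L subspace_diff[OF L orth_proj_mem[OF L] y], of z z]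
    by (simp add: orthogonal_def inner_commute)
  from norm_add_Pythagorean[OF this] have "(norm (z - orth_proj L z))\<^sup>2 \<le> (norm (z - y))\<^sup>2" by simp
  then show ?thesis by (rule power2_le_imp_le) simp
qed

lemma orth_proj_norm_le:
  fixes L :: "'a::euclidean_space set"
  assumes L: "subspace L"
  shows "norm (orth_proj L z) \<le> norm z"
proof -
  have "orthogonal (z - orth_proj L z) (orth_proj L z)"
    using inner_orth_proj_diff[OF L orth_proj_mem[OF L], of z z] by (simp add: orthogonal_def inner_commute)
  from norm_add_Pythagorean[OF this] have "(norm (orth_proj L z))\<^sup>2 \<le> (norm z)\<^sup>2" by simp
  then show ?thesis by (rule power2_le_imp_le) simp
qed

lemma subspace_dist_commute: "subspace_dist L1 L2 = subspace_dist L2 L1"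
  unfolding subspace_dist_def by (subst onorm_neg[symmetric]) simp

lemma subspace_dist_nonneg: "subspace L1 \<Longrightarrow> subspace L2 \<Longrightarrow> 0 \<le> subspace_dist L1 L2"
  unfolding subspace_dist_def by (intro onorm_pos_le bounded_linear_orth_proj_diff)

lemma subspace_dist_triangle:
  assumes "subspace L1" "subspace L2" "subspace L3"
  shows "subspace_dist L1 L3 \<le> subspace_dist L1 L2 + subspace_dist L2 L3"
  using onorm_triangle[OF bounded_linear_orth_proj_diff[OF assms(1,2)] bounded_linear_orth_proj_diff[OF assms(2,3)]]
  by (simp add: subspace_dist_def)

lemma subspace_dist_eq_0D:
  assumes L: "subspace L1" "subspace L2" and "subspace_dist L1 L2 = 0"
  shows "L1 = L2"
proof -
  have eq: "orth_proj L1 z = orth_proj L2 z" for z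
    using assms by (simp add: subspace_dist_def onorm_eq_0[OF bounded_linear_orth_proj_diff[OF L]])
  show ?thesis
    using orth_proj_ident[OF L(1)] orth_proj_ident[OF L(2)] orth_proj_mem[OF L(1)] orth_proj_mem[OF L(2)] eq
    by (metis subsetI subset_antisym)
qed

text \<open>With \<open>P\<^sub>i\<close> the projections, \<open>P\<^sub>1 - P\<^sub>2 = P\<^sub>1 (1 - P\<^sub>2) - (1 - P\<^sub>1) P\<^sub>2\<close>; the second gap bounds
  \<open>(1 - P\<^sub>1) P\<^sub>2\<close> and the first one bounds \<open>(1 - P\<^sub>2) P\<^sub>1\<close>, the adjoint of \<open>P\<^sub>1 (1 - P\<^sub>2)\<close>.\<close>

lemma subspace_dist_le_gaps:
  fixes L1 L2 :: "'a::euclidean_space set"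
  assumes L: "subspace L1" "subspace L2" and d: "0 \<le> d"
    and gap1: "\<And>w. w \<in> L1 \<Longrightarrow> norm (w - orth_proj L2 w) \<le> d * norm w"
    and gap2: "\<And>w. w \<in> L2 \<Longrightarrow> norm (w - orth_proj L1 w) \<le> d * norm w"
  shows "subspace_dist L1 L2 \<le> 2 * d"
  unfolding subspace_dist_def
proof (rule onorm_bound)
  fix z
  define y where "y = z - orth_proj L2 z"
  define w where "w = orth_proj L1 y"
  have wL: "w \<in> L1" unfolding w_def by (rule orth_proj_mem[OF L(1)])
  \<comment> \<open>The adjoint argument in terms of inner products: moving both projections across
    turns |w|^2 into the inner product of \<open>w - orth_proj L2 w\<close> with \<open>z\<close>,
    where the first gap applies.\<close>
  have "norm w * norm w = w \<bullet> y"
    using inner_orth_proj_diff[OF L(1) wL, of y] by (simp add: w_def inner_diff_right flip: power2_eq_square power2_norm_eq_inner)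
  also have "\<dots> = (w - orth_proj L2 w) \<bullet> z"
  proof -
    have "orth_proj L2 w \<bullet> (z - orth_proj L2 z) = 0" "orth_proj L2 z \<bullet> (w - orth_proj L2 w) = 0"
      by (intro inner_orth_proj_diff L orth_proj_mem)+
    then show ?thesis by (simp add: y_def inner_diff_left inner_diff_right inner_commute)
  qed
  also have "\<dots> \<le> norm (w - orth_proj L2 w) * norm z" by (rule norm_cauchy_schwarz)
  also have "\<dots> \<le> (d * norm w) * norm z" using gap1[OF wL] by (intro mult_right_mono) auto
  finally have "norm w * norm w \<le> norm w * (d * norm z)" by (simp add: mult_ac)
  then have 1: "norm w \<le> d * norm z" using d by (cases "w = 0") auto
  have "norm (orth_proj L2 z - orth_proj L1 (orth_proj L2 z)) \<le> d * norm (orth_proj L2 z)"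
    by (rule gap2[OF orth_proj_mem[OF L(2)]])
  also have "\<dots> \<le> d * norm z" using d orth_proj_norm_le[OF L(2)] by (intro mult_left_mono)
  finally have 2: "norm (orth_proj L2 z - orth_proj L1 (orth_proj L2 z)) \<le> d * norm z" .
  have eq: "orth_proj L1 z - orth_proj L2 z = w - (orth_proj L2 z - orth_proj L1 (orth_proj L2 z))"
    using linear_diff[OF linear_orth_proj[OF L(1)]] by (simp add: w_def y_def)
  show "norm (orth_proj L1 z - orth_proj L2 z) \<le> 2 * d * norm z"
    unfolding eq using norm_triangle_ineq4[of w "orth_proj L2 z - orth_proj L1 (orth_proj L2 z)"] 1 2 by simp
qed (use d in simp)

text \<open>For w = A x the vector \<open>A' x\<close> competes with the projection of
  \<open>w\<close>, and the lower bound on \<open>A\<close> turns an error relative to |x| into one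
  relative to |w|.\<close>

lemma range_gap:
  fixes A A' :: "'a::euclidean_space \<Rightarrow> 'b::euclidean_space"
  assumes A': "linear A'" and c: "c > 0" and below: "\<And>x. c * norm x \<le> norm (A x)"
    and close: "\<And>x. norm (A x - A' x) \<le> e * norm x" and w: "w \<in> range A" and e: "0 \<le> e"
  shows "norm (w - orth_proj (range A') w) \<le> e / c * norm w"
proof -
  obtain x where x: "w = A x" using w by auto
  have "norm (w - orth_proj (range A') w) \<le> norm (w - A' x)"
    by (intro orth_proj_nearest) (auto intro: linear_subspace_image A' subspace_UNIV)
  also have "\<dots> \<le> e * norm x" unfolding x by (rule close)
  also have "\<dots> \<le> e * (norm (A x) / c)"
    using below[of x] c e by (intro mult_left_mono) (auto simp: field_simps)
  finally show ?thesis by (simp add: x)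
qed

text \<open>In finite dimension pointwise convergence is convergence in norm. An injective
  \<open>A\<close> is bounded below, and nearby maps inherit half of that bound, so both gaps
  between the ranges tend to 0.\<close>

lemma subspace_dist_range_tendsto:
  fixes A :: "'a::euclidean_space \<Rightarrow> 'b::euclidean_space"
  assumes A: "linear A" "inj A" and Ak: "\<And>k. linear (Ak k)"
    and lim: "\<And>x. (\<lambda>k. Ak k x) \<longlonglongrightarrow> A x"
  shows "(\<lambda>k. subspace_dist (range A) (range (Ak k))) \<longlonglongrightarrow> 0"
proof -
  obtain c where c: "c > 0" "\<And>x. c * norm x \<le> norm (A x)" using linear_inj_bounded_below_pos[OF A] by blast
  \<comment> \<open>An upper bound for the operator norm of \<open>A - Ak k\<close>, read off from
    the basis vectors.\<close>
  define e where "e k = (\<Sum>b\<in>Basis. norm (A b - Ak k b))" for k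
  have e0: "0 \<le> e k" for k unfolding e_def by (intro sum_nonneg) simp
  have close: "norm (A x - Ak k x) \<le> e k * norm x" for k x
  proof -
    have lin: "linear (\<lambda>x. A x - Ak k x)" using A(1) Ak by (rule linear_compose_sub)
    have "A x - Ak k x = (\<Sum>b\<in>Basis. (x \<bullet> b) *\<^sub>R (A b - Ak k b))"
      using linear_sum[OF lin, of "\<lambda>b. (x \<bullet> b) *\<^sub>R b" Basis]
      unfolding euclidean_representation linear_scale[OF lin] .
    then have "norm (A x - Ak k x) = norm (\<Sum>b\<in>Basis. (x \<bullet> b) *\<^sub>R (A b - Ak k b))" by (rule arg_cong)
    also have "\<dots> \<le> (\<Sum>b\<in>Basis. norm x * norm (A b - Ak k b))"
      unfolding norm_scaleR by (intro sum_norm_le) (simp add: mult_right_mono Basis_le_norm)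
    finally show ?thesis by (simp add: e_def sum_distrib_left mult.commute)
  qed
  have "(\<lambda>k. A x - Ak k x) \<longlonglongrightarrow> 0" for x using tendsto_diff[OF tendsto_const lim, of "A x" x] by simp
  then have e: "e \<longlonglongrightarrow> 0" unfolding e_def by (intro tendsto_null_sum tendsto_norm_zero)
  have sub: "subspace (range A)" "subspace (range (Ak k))" for k
    by (intro linear_subspace_image subspace_UNIV A(1) Ak)+
  have "c / 2 > 0" using c(1) by simp
  have upper: "\<forall>\<^sub>F k in sequentially. subspace_dist (range A) (range (Ak k)) \<le> 2 * (e k / (c / 2))"
    using order_tendstoD(2)[OF e \<open>c / 2 > 0\<close>]
  proof eventually_elim
    case (elim k)
    have below: "c / 2 * norm x \<le> norm (Ak k x)" for x
    proof -
      have "c * norm x \<le> norm (Ak k x) + norm (A x - Ak k x)"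
        using c(2)[of x] norm_triangle_ineq[of "Ak k x" "A x - Ak k x"] by simp
      also have "norm (A x - Ak k x) \<le> c / 2 * norm x"
        using elim by (intro order_trans[OF close] mult_right_mono) auto
      finally have "c * norm x \<le> norm (Ak k x) + c / 2 * norm x" by simp
      then show ?thesis by linarith
    qed
    have below': "c / 2 * norm x \<le> norm (A x)" for x
    proof -
      have "c / 2 * norm x \<le> c * norm x" using c(1) by (intro mult_right_mono) auto
      also note c(2)
      finally show ?thesis .
    qed
    have "subspace_dist (range A) (range (Ak k)) \<le> 2 * (e k / (c / 2))"
    proof (rule subspace_dist_le_gaps[OF sub])
      fix w
      show "norm (w - orth_proj (range (Ak k)) w) \<le> e k / (c / 2) * norm w" if "w \<in> range A"
        by (rule range_gap[OF Ak \<open>c / 2 > 0\<close> below' close that e0])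
      have close': "norm (Ak k x - A x) \<le> e k * norm x" for x
        using close[of x k] by (simp only: norm_minus_commute)
      show "norm (w - orth_proj (range A) w) \<le> e k / (c / 2) * norm w" if "w \<in> range (Ak k)"
        by (rule range_gap[OF A(1) \<open>c / 2 > 0\<close> below close' that e0])
    qed (use e0 c(1) in simp)
    then show ?case .
  qed
  have "(\<lambda>k. 2 * (e k / (c / 2))) \<longlonglongrightarrow> 2 * (0 / (c / 2))"
    using c(1) by (intro tendsto_mult tendsto_divide tendsto_const e) simp
  then have lim0: "(\<lambda>k. 2 * (e k / (c / 2))) \<longlonglongrightarrow> 0" by (simp only: div_0 mult_zero_right)
  have "\<forall>\<^sub>F k in sequentially. 0 \<le> subspace_dist (range A) (range (Ak k))"
    by (intro always_eventually allI subspace_dist_nonneg sub)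
  then show ?thesis by (rule tendsto_sandwich[OF _ upper tendsto_const lim0])
qed


section \<open>Adjoint subspaces\<close>

lemma linear_S_mat: "linear S_mat"
  by (rule linearI) (auto simp: S_mat_def)

lemma inner_S_mat: "S_mat x \<bullet> S_mat y = x \<bullet> y"
  by (simp add: S_mat_def inner_Pair_0 case_prod_beta inner_prod_def)

lemma norm_S_mat: "norm (S_mat x) = norm x"
  by (simp add: norm_eq_sqrt_inner inner_S_mat)

lemma S_mat_S_mat: "S_mat (S_mat x) = - x"
  by (simp add: S_mat_def case_prod_beta prod_eq_iff)

lemma adjoint_S_mat: "adjoint S_mat = (\<lambda>x. - S_mat x)"
  by (rule adjoint_unique) (simp add: S_mat_def case_prod_beta inner_prod_def)

lemma inj_S_mat: "inj S_mat"
  by (rule injI) (metis S_mat_S_mat neg_equal_iff_equal)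

lemma adj_subspace_eq: "adj_subspace L = S_mat ` orthogonal_comp L"
  by (force simp: adj_subspace_def S_mat_def)

text \<open>The square of \<open>S_mat\<close> is -I, so its inverse is \<open>- S_mat\<close>, and
  the sign is absorbed by the subspace.\<close>

lemma mem_adj_subspace_iff: "w \<in> adj_subspace L \<longleftrightarrow> S_mat w \<in> orthogonal_comp L"
proof
  assume "w \<in> adj_subspace L"
  then obtain v where "v \<in> orthogonal_comp L" "w = S_mat v" unfolding adj_subspace_eq by blast
  then show "S_mat w \<in> orthogonal_comp L" by (simp add: S_mat_S_mat subspace_neg subspace_orthogonal_comp)
next
  assume "S_mat w \<in> orthogonal_comp L"
  then have "- S_mat w \<in> orthogonal_comp L" by (simp add: subspace_neg subspace_orthogonal_comp)
  moreover have "w = S_mat (- S_mat w)" by (simp add: linear_neg[OF linear_S_mat] S_mat_S_mat)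
  ultimately show "w \<in> adj_subspace L" unfolding adj_subspace_eq by blast
qed

lemma subspace_adj_subspace: "subspace (adj_subspace L)"
  unfolding adj_subspace_eq by (intro linear_subspace_image linear_S_mat subspace_orthogonal_comp)

text \<open>\<open>S_mat\<close> preserves inner products and so commutes with orthogonal
  complements; what remains is the double complement.\<close>

lemma adj_subspace_adj_subspace:
  assumes "subspace L"
  shows "adj_subspace (adj_subspace L) = L"
proof -
  have "w \<in> adj_subspace (adj_subspace L) \<longleftrightarrow> w \<in> orthogonal_comp (orthogonal_comp L)" for w
    unfolding mem_adj_subspace_iff[of w] unfolding adj_subspace_eq[of L]
    by (auto simp: orthogonal_comp_def orthogonal_def inner_S_mat)
  then show ?thesis using orthogonal_comp_self[OF assms] by blast
qed

lemma adj_subspace_half_dim: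
  fixes L :: "((real^'n) \<times> (real^'n)) set"
  assumes "L \<in> half_dim_subspaces"
  shows "adj_subspace L \<in> half_dim_subspaces"
proof -
  have L: "subspace L" "dim L = CARD('n)" using assms by (auto simp: half_dim_subspaces_def)
  have "orthogonal_comp L = {y \<in> UNIV. \<forall>x\<in>L. orthogonal x y}" by (auto simp: orthogonal_comp_def)
  then have "dim (orthogonal_comp L) + dim L = DIM((real^'n) \<times> (real^'n))"
    using dim_subspace_orthogonal_to_vectors[OF L(1) subspace_UNIV] by (simp add: dim_UNIV)
  then have "dim (orthogonal_comp L) = CARD('n)" using L(2) by simp
  then have "dim (adj_subspace L) = CARD('n)"
    unfolding adj_subspace_eq using inj_S_mat linear_S_mat
    by (subst dim_image_eq) (auto intro: inj_on_subset)
  then show ?thesis using subspace_adj_subspace by (simp add: half_dim_subspaces_def)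
qed

text \<open>With P the projection onto \<open>L\<close> and S for \<open>S_mat\<close>, the
  projection onto the image of the complement is S (I - P) S^(-1). Since S^(-1) = -S, this is I + S
  P S.\<close>

lemma orth_proj_adj_subspace:
  assumes L: "subspace L"
  shows "orth_proj (adj_subspace L) z = z + S_mat (orth_proj L (S_mat z))"
proof (rule orth_proj_eqI[OF subspace_adj_subspace])
  show "z + S_mat (orth_proj L (S_mat z)) \<in> adj_subspace L"
    unfolding mem_adj_subspace_iff using orth_proj_diff[OF L, of "S_mat z"]
    by (simp add: linear_add[OF linear_S_mat] S_mat_S_mat)
  show "z - (z + S_mat (orth_proj L (S_mat z))) \<in> orthogonal_comp (adj_subspace L)"
  proof -
    have "S_mat (orth_proj L (S_mat z)) \<bullet> S_mat w = 0" if "w \<in> orthogonal_comp L" for w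
      using that orth_proj_mem[OF L, of "S_mat z"] by (simp add: inner_S_mat orthogonal_comp_def orthogonal_def)
    then show ?thesis by (auto simp: adj_subspace_eq orthogonal_comp_def orthogonal_def inner_commute)
  qed
qed

text \<open>The difference of the adjoint projections is S (P1 - P2) S with S orthogonal, so its
  norm does not grow; the involution gives the reverse inequality.\<close>

lemma subspace_dist_adj_subspace:
  fixes L1 L2 :: "((real^'n) \<times> (real^'n)) set"
  assumes "subspace L1" "subspace L2"
  shows "subspace_dist (adj_subspace L1) (adj_subspace L2) = subspace_dist L1 L2"
proof -
  have le: "subspace_dist (adj_subspace L1) (adj_subspace L2) \<le> subspace_dist L1 L2"
    if L: "subspace L1" "subspace L2" for L1 L2 :: "((real^'n) \<times> (real^'n)) set"
    unfolding subspace_dist_def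
  proof (rule onorm_bound)
    show "0 \<le> onorm (\<lambda>z. orth_proj L1 z - orth_proj L2 z)"
      by (intro onorm_pos_le bounded_linear_orth_proj_diff L)
    fix z
    have "orth_proj (adj_subspace L1) z - orth_proj (adj_subspace L2) z
        = S_mat (orth_proj L1 (S_mat z) - orth_proj L2 (S_mat z))"
      by (simp add: orth_proj_adj_subspace L linear_diff[OF linear_S_mat])
    then show "norm (orth_proj (adj_subspace L1) z - orth_proj (adj_subspace L2) z)
        \<le> onorm (\<lambda>z. orth_proj L1 z - orth_proj L2 z) * norm z"
      using onorm[OF bounded_linear_orth_proj_diff[OF L], of "S_mat z"] by (simp add: norm_S_mat)
  qed
  show ?thesis
    using le[OF assms] le[OF subspace_adj_subspace subspace_adj_subspace, of L1 L2]
    by (simp add: adj_subspace_adj_subspace assms)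
qed

text \<open>Because of the isometric involution, one and the same sequence witnesses
  \<open>L\<close> on the adjoint side and \<open>adj_subspace L\<close> on the primal side.\<close>

lemma SCD_adj_eq:
  fixes F :: "real^'n \<Rightarrow> (real^'n) set"
  shows "SCD_adj F z = adj_subspace ` SCD F z"
proof -
  have eq: "subspace_dist L (adj_subspace (tangent_cone (gph F) (\<zeta> k)))
      = subspace_dist (adj_subspace L) (tangent_cone (gph F) (\<zeta> k))"
    if "L \<in> half_dim_subspaces" "\<And>k. \<zeta> k \<in> smooth_points F" for L and \<zeta> :: "nat \<Rightarrow> (real^'n) \<times> (real^'n)" and k
  proof -
    have T: "subspace (tangent_cone (gph F) (\<zeta> k))" and L: "subspace L"
      using that by (simp_all add: half_dim_subspaces_def smooth_points_def)
    show ?thesis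
      using subspace_dist_adj_subspace[OF subspace_adj_subspace T, of L]
      by (simp only: adj_subspace_adj_subspace[OF L])
  qed
  have iff: "L \<in> SCD_adj F z \<longleftrightarrow> adj_subspace L \<in> SCD F z" if L: "L \<in> half_dim_subspaces" for L
  proof -
    have "(\<exists>\<zeta>. (\<forall>k::nat. \<zeta> k \<in> smooth_points F) \<and> \<zeta> \<longlonglongrightarrow> z \<and>
        (\<lambda>k. subspace_dist L (adj_subspace (tangent_cone (gph F) (\<zeta> k)))) \<longlonglongrightarrow> 0) \<longleftrightarrow>
      (\<exists>\<zeta>. (\<forall>k::nat. \<zeta> k \<in> smooth_points F) \<and> \<zeta> \<longlonglongrightarrow> z \<and>
        (\<lambda>k. subspace_dist (adj_subspace L) (tangent_cone (gph F) (\<zeta> k))) \<longlonglongrightarrow> 0)"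
      by (intro ex_cong1 conj_cong refl) (simp only: eq[OF L])
    then show ?thesis
      unfolding SCD_adj_def SCD_def mem_Collect_eq using L adj_subspace_half_dim[OF L] by simp
  qed
  show ?thesis
  proof (intro equalityI subsetI)
    fix L assume "L \<in> SCD_adj F z"
    moreover from this have "L \<in> half_dim_subspaces" by (simp add: SCD_adj_def)
    ultimately show "L \<in> adj_subspace ` SCD F z"
      using iff[of L] adj_subspace_adj_subspace[of L]
      by (intro image_eqI[of _ _ "adj_subspace L"]) (simp_all add: half_dim_subspaces_def)
  next
    fix L assume "L \<in> adj_subspace ` SCD F z"
    then obtain L' where L': "L' \<in> SCD F z" "L = adj_subspace L'" by blast
    then have "L' \<in> half_dim_subspaces" by (simp add: SCD_def)
    then show "L \<in> SCD_adj F z"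
      using L' iff[OF adj_subspace_half_dim] by (simp add: adj_subspace_adj_subspace half_dim_subspaces_def)
  qed
qed

text \<open>For T inverse to D, the complement of T L is the image of the complement of
  \<open>L\<close> under the transpose of D. Inserting the transpose of \<open>S_mat\<close>, which
  is its inverse, moves the statement to adjoint subspaces.\<close>

lemma adj_subspace_inverse_image:
  fixes D T :: "(real^'n) \<times> (real^'n) \<Rightarrow> (real^'n) \<times> (real^'n)"
  assumes lin: "linear D" "linear T" and inv: "\<And>x. D (T x) = x" "\<And>x. T (D x) = x"
  shows "adj_subspace (T ` L) = (S_mat \<circ> adjoint D \<circ> adjoint S_mat) ` adj_subspace L"
proof -
  have "orthogonal_comp (T ` L) = adjoint D ` orthogonal_comp L"
  proof (intro equalityI subsetI)
    fix w assume w: "w \<in> orthogonal_comp (T ` L)"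
    have "adjoint T w \<in> orthogonal_comp L"
      using w by (auto simp: orthogonal_comp_def orthogonal_def adjoint_works[OF lin(2)])
    moreover have "w = adjoint D (adjoint T w)"
      by (rule vector_eq_ldot[THEN iffD1]) (simp add: adjoint_works lin inv)
    ultimately show "w \<in> adjoint D ` orthogonal_comp L" by blast
  next
    fix w assume "w \<in> adjoint D ` orthogonal_comp L"
    then show "w \<in> orthogonal_comp (T ` L)"
      by (auto simp: orthogonal_comp_def orthogonal_def adjoint_works[OF lin(1)] inv)
  qed
  then show ?thesis
    by (simp add: adj_subspace_eq image_image adjoint_S_mat S_mat_S_mat)
qed

lemma linear_stack_id: "linear (stack_id B)"
  by (rule linearI) (auto simp: stack_id_def matrix_vector_right_distrib matrix_vector_mult_scaleR)

lemma inj_stack_id: "inj (stack_id B)"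
  by (auto simp: inj_def stack_id_def)

text \<open>Orthogonality to the range means u = -B^T v, so the elements (-v, u) of the adjoint
  subspace are (p, B^T p) with p = -v.\<close>

lemma adj_subspace_stack_id: "adj_subspace (range (stack_id B)) = range (stack_id (transpose B))"
proof -
  have perp: "(u, v) \<in> orthogonal_comp (range (stack_id B)) \<longleftrightarrow> u = - (transpose B *v v)" for u v
  proof -
    have "stack_id B p \<bullet> (u, v) = p \<bullet> (u + transpose B *v v)" for p
      by (simp add: stack_id_def inner_add_right inner_commute[of "B *v p"] flip: dot_lmul_matrix)
         (simp add: inner_commute)
    then have "(u, v) \<in> orthogonal_comp (range (stack_id B)) \<longleftrightarrow> (\<forall>p. p \<bullet> (u + transpose B *v v) = 0)"
      by (auto simp: orthogonal_comp_def orthogonal_def simp del: transpose_matrix_vector)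
    also have "\<dots> \<longleftrightarrow> u + transpose B *v v = 0" by (metis inner_eq_zero_iff inner_zero_right)
    finally show ?thesis by (simp add: eq_neg_iff_add_eq_0)
  qed
  have neg: "transpose B *v (- v) = - (transpose B *v v)" for v
    using matrix_vector_mult_scaleR[of "transpose B" "-1" v] by simp
  show ?thesis
  proof (intro equalityI subsetI)
    fix w assume "w \<in> adj_subspace (range (stack_id B))"
    then obtain u v where w: "w = (- v, u)" "u = - (transpose B *v v)" unfolding adj_subspace_def perp by blast
    then have "w = stack_id (transpose B) (- v)" unfolding stack_id_def neg by simp
    then show "w \<in> range (stack_id (transpose B))" by blast
  next
    fix w assume "w \<in> range (stack_id (transpose B))"
    then obtain v where "w = stack_id (transpose B) v" by blast
    then have "w = (- (- v), - (transpose B *v (- v)))" unfolding stack_id_def neg by simp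
    then show "w \<in> adj_subspace (range (stack_id B))" unfolding adj_subspace_def perp by blast
  qed
qed

section \<open>Limits of tangent spaces\<close>

lemma tangent_cone_graph_jacobian:
  fixes f :: "real^'n \<Rightarrow> real^'n"
  assumes "open U" "u \<in> U" "f differentiable (at u)"
  shows "tangent_cone (gph (single_valued U f)) (u, f u) = range (stack_id (jacobian f (at u)))"
  using tangent_cone_graph[OF assms(1,2) jacobian_works[THEN iffD1, OF assms(3)]]
  by (simp add: stack_id_def)

text \<open>The vector with parts h and J h is tangent to the graph, where J is the Jacobian, so it
  obeys the Lipschitz bound for tangent vectors.\<close>

lemma norm_jacobian_mult_le:
  fixes f :: "real^'n \<Rightarrow> real^'n"
  assumes "open U" "u \<in> U" "f differentiable (at u)" "C-lipschitz_on U f"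
  shows "norm (jacobian f (at u) *v h) \<le> C * norm h"
proof -
  have "stack_id (jacobian f (at u)) h \<in> tangent_cone (gph (single_valued U f)) (u, f u)"
    unfolding tangent_cone_graph_jacobian[OF assms(1-3)] by blast
  from tangent_cone_graph_lipschitz[OF assms(4,2) this] show ?thesis by (simp add: stack_id_def)
qed

lemma half_dim_range_stack_id:
  fixes T :: "(real^'n) \<times> (real^'n) \<Rightarrow> (real^'n) \<times> (real^'n)"
  assumes "linear T" "inj T"
  shows "range (T \<circ> stack_id B) \<in> half_dim_subspaces"
proof -
  have lin: "linear (T \<circ> stack_id B)" using linear_stack_id assms(1) by (rule linear_compose)
  have inj: "inj (T \<circ> stack_id B)" using assms(2) inj_stack_id by (rule inj_compose)
  have "dim (range (T \<circ> stack_id B)) = dim (UNIV :: (real^'n) set)"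
    by (rule dim_image_eq[OF lin]) (use inj in simp)
  then show ?thesis
    using linear_subspace_image[OF lin subspace_UNIV] by (simp add: half_dim_subspaces_def dim_UNIV)
qed

lemma matrices_convergent_subsequence:
  fixes B :: "nat \<Rightarrow> real^'n^'m"
  assumes bound: "\<And>k h. norm (B k *v h) \<le> C * norm h"
  obtains s A where "strict_mono s" "(B \<circ> s) \<longlonglongrightarrow> A"
proof -
  have entry: "norm (B k $ i $ j) \<le> C" for k i j
  proof -
    have "norm (B k $ i $ j) = norm ((B k *v axis j 1) $ i)" by (simp add: matrix_vector_mult_basis column_def)
    also have "\<dots> \<le> norm (B k *v axis j 1)" by (rule Finite_Cartesian_Product.norm_nth_le)
    also have "\<dots> \<le> C" using bound[of k "axis j 1"] by simp
    finally show ?thesis .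
  qed
  have "norm (B k) \<le> (\<Sum>i\<in>(UNIV::'m set). \<Sum>j\<in>(UNIV::'n set). C)" for k
  proof -
    have "norm (B k) \<le> (\<Sum>i\<in>UNIV. norm (B k $ i))" unfolding norm_vec_def by (rule L2_set_le_sum) simp
    also have "\<dots> \<le> (\<Sum>i\<in>UNIV. \<Sum>j\<in>UNIV. norm (B k $ i $ j))"
      by (intro sum_mono) (simp add: norm_vec_def L2_set_le_sum)
    also have "\<dots> \<le> (\<Sum>i\<in>(UNIV::'m set). \<Sum>j\<in>(UNIV::'n set). C)" by (intro sum_mono entry)
    finally show ?thesis .
  qed
  then have "bounded (range B)" unfolding bounded_iff by blast
  then show ?thesis using bounded_imp_convergent_subsequence that by blast
qed

lemma tendsto_stack_id:
  assumes "B \<longlonglongrightarrow> A"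
  shows "(\<lambda>k. stack_id (B k) x) \<longlonglongrightarrow> stack_id A x"
proof -
  have "(\<lambda>k. B k *v x) \<longlonglongrightarrow> A *v x"
    unfolding matrix_vector_mult_def
    by (intro vec_tendstoI) (simp, intro tendsto_sum tendsto_mult tendsto_const tendsto_vec_nth assms)
  then show ?thesis unfolding stack_id_def by (intro tendsto_Pair tendsto_const)
qed

text \<open>Differentiability points at distance below 1/(k+1) come from Rademacher's theorem; their
  Jacobians are bounded by the Lipschitz constant, so a subsequence converges.\<close>

lemma B_subdiff_nonempty:
  fixes f :: "real^'n \<Rightarrow> real^'n"
  assumes U: "open U" "u \<in> U" and lip: "C-lipschitz_on U f"
  shows "B_subdiff U f u \<noteq> {}"
proof -
  have "\<exists>x. x \<in> U \<and> dist x u < inverse (real (Suc k)) \<and> f differentiable (at x)" for k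
    using Rademacher_dense[OF U lip, of "inverse (real (Suc k))"] by (metis inverse_Suc)
  then obtain x where x: "\<And>k. x k \<in> U" "\<And>k. dist (x k) u < inverse (real (Suc k))"
    "\<And>k. f differentiable (at (x k))" by metis
  have "x \<longlonglongrightarrow> u"
    by (rule metric_tendsto_imp_tendsto[OF LIMSEQ_inverse_real_of_nat])
       (use x(2) in \<open>auto intro!: always_eventually less_imp_le\<close>)
  obtain s B where s: "strict_mono s" "((\<lambda>k. jacobian f (at (x k))) \<circ> s) \<longlonglongrightarrow> B"
    using matrices_convergent_subsequence[of "\<lambda>k. jacobian f (at (x k))" C]
      norm_jacobian_mult_le[OF U(1) x(1) x(3) lip] by blast
  have "B \<in> B_subdiff U f u" unfolding B_subdiff_def
    using x s(2) LIMSEQ_subseq_LIMSEQ[OF \<open>x \<longlonglongrightarrow> u\<close> s(1)]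
    by (intro CollectI exI[of _ "x \<circ> s"]) (simp add: comp_def)
  then show ?thesis by blast
qed

section \<open>Transport of tangent spaces by the transformation\<close>

lemma transformation_derivative:
  fixes \<Phi> :: "'a::euclidean_space \<Rightarrow> 'a"
  assumes W: "open W" and inj: "inj_on \<Phi> W" and im: "open (\<Phi> ` W)"
    and C1: "continuously_differentiable_on \<Phi> W"
    and C1': "continuously_differentiable_on (the_inv_into W \<Phi>) (\<Phi> ` W)"
  obtains T :: "'a \<Rightarrow> 'a \<Rightarrow>\<^sub>L 'a"
  where "\<And>z. z \<in> W \<Longrightarrow> (\<Phi> has_derivative frechet_derivative \<Phi> (at z)) (at z)"
    and "\<And>z. z \<in> W \<Longrightarrow> (the_inv_into W \<Phi> has_derivative T z) (at (\<Phi> z))"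
    and "\<And>z x. z \<in> W \<Longrightarrow> frechet_derivative \<Phi> (at z) (T z x) = x"
    and "\<And>z x. z \<in> W \<Longrightarrow> T z (frechet_derivative \<Phi> (at z) x) = x"
    and "continuous_on W T"
proof -
  let ?\<Psi> = "the_inv_into W \<Phi>"
  obtain \<Phi>' :: "'a \<Rightarrow> 'a \<Rightarrow>\<^sub>L 'a" where \<Phi>': "\<And>z. z \<in> W \<Longrightarrow> (\<Phi> has_derivative \<Phi>' z) (at z)"
    using C1 unfolding continuously_differentiable_on_def by blast
  obtain \<Psi>' :: "'a \<Rightarrow> 'a \<Rightarrow>\<^sub>L 'a" where \<Psi>': "\<And>y. y \<in> \<Phi> ` W \<Longrightarrow> (?\<Psi> has_derivative \<Psi>' y) (at y)"
    and cont: "continuous_on (\<Phi> ` W) \<Psi>'"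
    using C1' unfolding continuously_differentiable_on_def by blast
  have T': "(?\<Psi> has_derivative \<Psi>' (\<Phi> z)) (at (\<Phi> z))" if "z \<in> W" for z using \<Psi>' that by blast
  \<comment> \<open>Differentiating both compositions of \<Phi> with its inverse, which are the
    identity on the open sets \<open>W\<close> and \<Phi>(W), shows that the two derivatives are
    inverse to each other.\<close>
  have 1: "\<Psi>' (\<Phi> z) (\<Phi>' z x) = x" if z: "z \<in> W" for z x
  proof -
    have "((\<lambda>y. ?\<Psi> (\<Phi> y)) has_derivative (\<lambda>x. \<Psi>' (\<Phi> z) (\<Phi>' z x))) (at z)"
      by (rule has_derivative_compose[OF \<Phi>'[OF z] T'[OF z]])
    then have "((\<lambda>y. y) has_derivative (\<lambda>x. \<Psi>' (\<Phi> z) (\<Phi>' z x))) (at z)"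
      by (rule has_derivative_transform_within_open[OF _ W z]) (simp add: the_inv_into_f_f[OF inj])
    from has_derivative_unique[OF this has_derivative_ident] show ?thesis by (simp add: fun_eq_iff)
  qed
  have 2: "\<Phi>' z (\<Psi>' (\<Phi> z) x) = x" if z: "z \<in> W" for z x
  proof -
    have "(\<Phi> has_derivative \<Phi>' z) (at (?\<Psi> (\<Phi> z)))" using \<Phi>'[OF z] by (simp add: the_inv_into_f_f[OF inj z])
    from has_derivative_compose[OF T'[OF z] this]
    have "((\<lambda>y. \<Phi> (?\<Psi> y)) has_derivative (\<lambda>x. \<Phi>' z (\<Psi>' (\<Phi> z) x))) (at (\<Phi> z))" .
    then have "((\<lambda>y. y) has_derivative (\<lambda>x. \<Phi>' z (\<Psi>' (\<Phi> z) x))) (at (\<Phi> z))"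
      by (rule has_derivative_transform_within_open[OF _ im imageI[OF z]]) (simp add: f_the_inv_into_f[OF inj])
    from has_derivative_unique[OF this has_derivative_ident] show ?thesis by (simp add: fun_eq_iff)
  qed
  have "continuous_on W \<Phi>"
    using has_derivative_continuous[OF \<Phi>'] by (simp add: continuous_at_imp_continuous_on)
  then have "continuous_on W (\<lambda>z. \<Psi>' (\<Phi> z))" by (rule continuous_on_compose2[OF cont]) simp
  moreover have "frechet_derivative \<Phi> (at z) = \<Phi>' z" if "z \<in> W" for z
    using frechet_derivative_at[OF \<Phi>'[OF that]] by simp
  ultimately show ?thesis using that[of "\<lambda>z. \<Psi>' (\<Phi> z)"] \<Phi>' T' 1 2 by simp
qed

text \<open>At a smooth point y the tangent space is the range of the inverse derivative at y
  applied to (I, J), with J the Jacobian of \<open>f\<close> below \<Phi>(y). One inclusion extracts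
  a convergent subsequence of Jacobians; the other pulls a sequence of differentiability points back
  to the graph of \<open>F\<close>.\<close>

lemma SCD_graphically_lipschitzian:
  fixes F :: "real^'n \<Rightarrow> (real^'n) set"
  assumes G: "graphically_lipschitzian F z0 \<Phi> W U f" and z: "z \<in> gph F" "z \<in> W"
  shows "SCD F z = {range (inv (frechet_derivative \<Phi> (at z)) \<circ> stack_id B) |B. B \<in> B_subdiff U f (fst (\<Phi> z))}"
proof -
  have W: "open W" and inj: "inj_on \<Phi> W" and im: "open (\<Phi> ` W)" and U: "open U"
    and graph: "\<Phi> ` (gph F \<inter> W) = gph (single_valued U f)"
    and C1: "continuously_differentiable_on \<Phi> W" "continuously_differentiable_on (the_inv_into W \<Phi>) (\<Phi> ` W)"
    using G unfolding graphically_lipschitzian_def by blast+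
  obtain C where lip: "C-lipschitz_on U f" using G unfolding graphically_lipschitzian_def by blast
  let ?\<Psi> = "the_inv_into W \<Phi>"
  let ?J = "\<lambda>u. jacobian f (at u)"
  define D where "D y = frechet_derivative \<Phi> (at y)" for y
  obtain T' where D: "\<And>z. z \<in> W \<Longrightarrow> (\<Phi> has_derivative D z) (at z)"
    and T': "\<And>z. z \<in> W \<Longrightarrow> (?\<Psi> has_derivative blinfun_apply (T' z)) (at (\<Phi> z))"
    and DT': "\<And>z x. z \<in> W \<Longrightarrow> D z (T' z x) = x" and T'D: "\<And>z x. z \<in> W \<Longrightarrow> T' z (D z x) = x"
    and contT: "continuous_on W T'"
    unfolding D_def using transformation_derivative[OF W inj im C1] by blast
  define T where "T y = blinfun_apply (T' y)" for y
  note T = T'[folded T_def] and DT = DT'[folded T_def] and TD = T'D[folded T_def]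
  \<comment> \<open>Convergence of the inverse derivatives in operator norm allows operator and
    argument to vary together.\<close>
  have T_lim: "(\<lambda>k. T (\<zeta> k) (v k)) \<longlonglongrightarrow> T z x"
    if "\<And>k::nat. \<zeta> k \<in> W" "\<zeta> \<longlonglongrightarrow> z" "v \<longlonglongrightarrow> x" for \<zeta> v x
    unfolding T_def
    by (intro blinfun.tendsto continuous_on_tendsto_compose[OF contT that(2) z(2)] that(3))
      (simp add: that(1))
  have linT: "linear (T y)" and linD: "linear (D y)" if "y \<in> W" for y
    using has_derivative_linear T D that by blast+
  have injT: "inj (T y)" and injD: "inj (D y)" if "y \<in> W" for y
    by (rule inj_on_inverseI, rule DT[OF that], rule inj_on_inverseI, rule TD[OF that])
  have invD: "inv (frechet_derivative \<Phi> (at z)) = T z"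
    using DT[OF z(2)] TD[OF z(2)] by (simp add: inv_equality D_def)
  have graph_pt: "fst (\<Phi> y) \<in> U" "\<Phi> y = (fst (\<Phi> y), f (fst (\<Phi> y)))" if "y \<in> gph F" "y \<in> W" for y
  proof -
    have "\<Phi> y \<in> gph (single_valued U f)" using that graph by blast
    then show "fst (\<Phi> y) \<in> U" "\<Phi> y = (fst (\<Phi> y), f (fst (\<Phi> y)))" by (auto simp: graph_as_image)
  qed
  \<comment> \<open>One inclusion from \<Phi>, the other from its inverse, after restricting the
    graph of \<open>F\<close> to \<open>W\<close>.\<close>
  have tangent: "tangent_cone (gph F) y = T y ` tangent_cone (gph (single_valued U f)) (\<Phi> y)"
    if y: "y \<in> gph F" "y \<in> W" for y
  proof
    have "tangent_cone (gph F) y = tangent_cone (gph F \<inter> W) y" using W y(2) by (rule tangent_cone_local[symmetric])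
    moreover have "D y w \<in> tangent_cone (gph (single_valued U f)) (\<Phi> y)" if "w \<in> tangent_cone (gph F \<inter> W) y" for w
      using tangent_cone_image[OF D[OF y(2)] that] graph by simp
    ultimately show "tangent_cone (gph F) y \<subseteq> T y ` tangent_cone (gph (single_valued U f)) (\<Phi> y)"
      using TD[OF y(2)] by (metis image_eqI subsetI)
    have "?\<Psi> ` gph (single_valued U f) = gph F \<inter> W"
      unfolding graph[symmetric] image_image using inj by (auto simp: the_inv_into_f_f image_iff)
    then have "T y w \<in> tangent_cone (gph F \<inter> W) y" if "w \<in> tangent_cone (gph (single_valued U f)) (\<Phi> y)" for w
      using tangent_cone_image[OF T[OF y(2)] that] by (simp add: the_inv_into_f_f[OF inj y(2)])
    then show "T y ` tangent_cone (gph (single_valued U f)) (\<Phi> y) \<subseteq> tangent_cone (gph F) y"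
      using tangent_cone_local[OF W y(2), of "gph F"] by auto
  qed
  have tangent_diff: "tangent_cone (gph F) y = range (T y \<circ> stack_id (?J (fst (\<Phi> y))))"
    if y: "y \<in> gph F" "y \<in> W" and diff: "f differentiable (at (fst (\<Phi> y)))" for y
  proof -
    have "tangent_cone (gph F) y = T y ` tangent_cone (gph (single_valued U f)) (fst (\<Phi> y), f (fst (\<Phi> y)))"
      using tangent[OF y] graph_pt(2)[OF y] by simp
    also have "\<dots> = range (T y \<circ> stack_id (?J (fst (\<Phi> y))))"
      unfolding tangent_cone_graph_jacobian[OF U graph_pt(1)[OF y] diff] by (simp add: image_comp)
    finally show ?thesis .
  qed
  \<comment> \<open>The isomorphism \<open>D y\<close> carries the n-dimensional tangent space of
    \<open>F\<close> to one of the graph of \<open>f\<close>, which for Lipschitz \<open>f\<close>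
    forces differentiability.\<close>
  have diff_if_smooth: "f differentiable (at (fst (\<Phi> y)))" if "y \<in> smooth_points F" "y \<in> W" for y
  proof -
    have y: "y \<in> gph F" and S: "tangent_cone (gph F) y \<in> half_dim_subspaces"
      using that(1) by (simp_all add: smooth_points_def)
    let ?L = "tangent_cone (gph (single_valued U f)) (\<Phi> y)"
    have L: "?L = D y ` tangent_cone (gph F) y"
      unfolding tangent[OF y that(2)] image_image DT[OF that(2)] by simp
    have "dim ?L = dim (tangent_cone (gph F) y)"
      unfolding L using injD[OF that(2)] by (intro dim_image_eq linD that(2)) (auto intro: inj_on_subset)
    moreover have "subspace ?L"
      unfolding L using S by (intro linear_subspace_image linD that(2)) (simp add: half_dim_subspaces_def)
    ultimately have "?L \<in> half_dim_subspaces" using S by (simp add: half_dim_subspaces_def)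
    then show ?thesis
      using differentiable_if_tangent_cone_half_dim[OF U graph_pt(1)[OF y that(2)] lip] graph_pt(2)[OF y that(2)] by simp
  qed
  have half_dim: "range (T y \<circ> stack_id B) \<in> half_dim_subspaces" if "y \<in> W" for y B
    using half_dim_range_stack_id linT injT that by blast
  have sub: "subspace (range (T y \<circ> stack_id B))" if "y \<in> W" for y B
    using half_dim[OF that, of B] by (simp add: half_dim_subspaces_def)
  have dist_lim: "(\<lambda>k. subspace_dist (range (T z \<circ> stack_id B)) (range (T (\<zeta> k) \<circ> stack_id (Bk k)))) \<longlonglongrightarrow> 0"
    if "\<And>k. \<zeta> k \<in> W" "\<zeta> \<longlonglongrightarrow> z" "Bk \<longlonglongrightarrow> B" for \<zeta> Bk B
  proof (rule subspace_dist_range_tendsto)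
    show "linear (T z \<circ> stack_id B)" by (intro linear_compose linear_stack_id linT z(2))
    show "linear (T (\<zeta> k) \<circ> stack_id (Bk k))" for k by (intro linear_compose linear_stack_id linT that(1))
    show "inj (T z \<circ> stack_id B)" by (intro inj_compose injT z(2) inj_stack_id)
    show "(\<lambda>k. (T (\<zeta> k) \<circ> stack_id (Bk k)) x) \<longlonglongrightarrow> (T z \<circ> stack_id B) x" for x
      unfolding comp_def by (intro T_lim that(1,2) tendsto_stack_id that(3))
  qed
  let ?u = "fst (\<Phi> z)"
  show ?thesis unfolding invD
  proof (intro equalityI subsetI)
    fix L assume "L \<in> SCD F z"
    then obtain \<zeta>0 where L: "L \<in> half_dim_subspaces" and \<zeta>0: "\<And>k::nat. \<zeta>0 k \<in> smooth_points F" "\<zeta>0 \<longlonglongrightarrow> z"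
      "(\<lambda>k. subspace_dist L (tangent_cone (gph F) (\<zeta>0 k))) \<longlonglongrightarrow> 0"
      unfolding SCD_def by blast
    \<comment> \<open>Only a tail of the sequence is known to lie in \<open>W\<close>, so the index
      is shifted.\<close>
    obtain N where N: "\<And>k. k \<ge> N \<Longrightarrow> \<zeta>0 k \<in> W"
      using topological_tendstoD[OF \<zeta>0(2) W z(2)] by (auto simp: eventually_sequentially)
    define \<zeta> where "\<zeta> = (\<lambda>k. \<zeta>0 (k + N))"
    have \<zeta>: "\<And>k. \<zeta> k \<in> W" "\<And>k. \<zeta> k \<in> smooth_points F" "\<And>k. \<zeta> k \<in> gph F" "\<zeta> \<longlonglongrightarrow> z"
      "(\<lambda>k. subspace_dist L (tangent_cone (gph F) (\<zeta> k))) \<longlonglongrightarrow> 0"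
      using N \<zeta>0 LIMSEQ_ignore_initial_segment[OF \<zeta>0(2), of N] LIMSEQ_ignore_initial_segment[OF \<zeta>0(3), of N]
      by (simp_all add: \<zeta>_def smooth_points_def)
    define x where "x k = fst (\<Phi> (\<zeta> k))" for k
    have xU: "x k \<in> U" for k unfolding x_def by (intro graph_pt \<zeta>)
    have diff: "f differentiable (at (x k))" for k unfolding x_def by (intro diff_if_smooth \<zeta>)
    have "isCont \<Phi> z" using D[OF z(2)] by (rule has_derivative_continuous)
    then have x: "x \<longlonglongrightarrow> ?u" unfolding x_def by (intro tendsto_fst isCont_tendsto_compose[OF _ \<zeta>(4)])
    obtain s B where s: "strict_mono s" "((\<lambda>k. ?J (x k)) \<circ> s) \<longlonglongrightarrow> B"
      using matrices_convergent_subsequence[of "\<lambda>k. ?J (x k)" C] norm_jacobian_mult_le[OF U xU diff lip] by blast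
    have B: "B \<in> B_subdiff U f ?u" unfolding B_subdiff_def
      using xU diff s(2) LIMSEQ_subseq_LIMSEQ[OF x s(1)]
      by (intro CollectI exI[of _ "x \<circ> s"]) (simp add: comp_def)
    let ?R = "range (T z \<circ> stack_id B)"
    let ?L = "\<lambda>k. tangent_cone (gph F) (\<zeta> (s k))"
    have Lk: "?L k = range (T (\<zeta> (s k)) \<circ> stack_id (?J (x (s k))))" for k
      unfolding x_def by (intro tangent_diff \<zeta> diff[unfolded x_def])
    have "(\<lambda>k. subspace_dist ?R (?L k)) \<longlonglongrightarrow> 0"
      unfolding Lk using LIMSEQ_subseq_LIMSEQ[OF \<zeta>(4) s(1)] s(2)
      by (intro dist_lim \<zeta>(1)) (simp_all add: comp_def)
    moreover have "(\<lambda>k. subspace_dist L (?L k)) \<longlonglongrightarrow> 0"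
      using LIMSEQ_subseq_LIMSEQ[OF \<zeta>(5) s(1)] by (simp add: comp_def)
    ultimately have lim: "(\<lambda>k. subspace_dist L (?L k) + subspace_dist ?R (?L k)) \<longlonglongrightarrow> 0"
      using tendsto_add by fastforce
    have sL: "subspace L" using L by (simp add: half_dim_subspaces_def)
    \<comment> \<open>Along the subsequence both \<open>L\<close> and \<open>?R\<close> are limits
      of the same tangent spaces, so they coincide.\<close>
    have "subspace_dist L ?R \<le> subspace_dist L (?L k) + subspace_dist ?R (?L k)" for k
      using subspace_dist_triangle[OF sL sub[OF \<zeta>(1)] sub[OF z(2)]] Lk[of k]
        subspace_dist_commute[of ?R "?L k"] by simp
    then have "subspace_dist L ?R \<le> 0" by (intro LIMSEQ_le_const[OF lim]) simp
    then have "subspace_dist L ?R = 0" using subspace_dist_nonneg[OF sL sub[OF z(2)], of B] by simp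
    then have "L = ?R" by (rule subspace_dist_eq_0D[OF sL sub[OF z(2)]])
    then show "L \<in> {range (T z \<circ> stack_id B) |B. B \<in> B_subdiff U f ?u}" using B by blast
  next
    fix L assume "L \<in> {range (T z \<circ> stack_id B) |B. B \<in> B_subdiff U f ?u}"
    then obtain B x where L: "L = range (T z \<circ> stack_id B)" and xU: "\<And>k::nat. x k \<in> U"
      and diff: "\<And>k. f differentiable (at (x k))" and x: "x \<longlonglongrightarrow> ?u" and B: "(\<lambda>k. ?J (x k)) \<longlonglongrightarrow> B"
      unfolding B_subdiff_def by blast
    \<comment> \<open>The graph points of \<open>f\<close> over \<open>x k\<close>, pulled back;
      they tend to \<open>z\<close> by continuity of \<open>f\<close> and of the inverse
      transformation.\<close>
    define \<zeta> where "\<zeta> k = ?\<Psi> (x k, f (x k))" for k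
    have \<zeta>: "\<zeta> k \<in> gph F \<and> \<zeta> k \<in> W \<and> \<Phi> (\<zeta> k) = (x k, f (x k))" for k
    proof -
      have "(x k, f (x k)) \<in> \<Phi> ` (gph F \<inter> W)" unfolding graph graph_as_image using xU by blast
      then obtain y where "y \<in> gph F" "y \<in> W" "(x k, f (x k)) = \<Phi> y" by blast
      then show ?thesis using the_inv_into_f_f[OF inj, of y] by (simp add: \<zeta>_def)
    qed
    have u: "?u \<in> U" by (rule graph_pt(1)[OF z])
    have "(\<lambda>k. f (x k)) \<longlonglongrightarrow> f ?u"
      by (rule continuous_on_tendsto_compose[OF lipschitz_on_continuous_on[OF lip] x u]) (simp add: xU)
    then have "(\<lambda>k. (x k, f (x k))) \<longlonglongrightarrow> \<Phi> z" using tendsto_Pair[OF x] graph_pt(2)[OF z] by fastforce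
    moreover have "isCont ?\<Psi> (\<Phi> z)" using T[OF z(2)] by (rule has_derivative_continuous)
    ultimately have lim: "\<zeta> \<longlonglongrightarrow> z"
      using isCont_tendsto_compose[of "\<Phi> z" ?\<Psi>] the_inv_into_f_f[OF inj z(2)] unfolding \<zeta>_def by fastforce
    have tan: "tangent_cone (gph F) (\<zeta> k) = range (T (\<zeta> k) \<circ> stack_id (?J (x k)))" for k
      using tangent_diff[of "\<zeta> k"] \<zeta>[of k] diff[of k] by simp
    have "\<zeta> k \<in> smooth_points F" for k
      using \<zeta>[of k] half_dim[of "\<zeta> k" "?J (x k)"] by (simp add: smooth_points_def tan)
    moreover have "(\<lambda>k. subspace_dist L (tangent_cone (gph F) (\<zeta> k))) \<longlonglongrightarrow> 0"
      unfolding tan L using \<zeta> lim B by (intro dist_lim) simp_all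
    ultimately show "L \<in> SCD F z"
      unfolding SCD_def using half_dim[OF z(2)] lim L by blast
  qed
qed

text \<open>With the identity as transformation, the general formula for \<open>SCD\<close>
  specializes to Lipschitz functions.\<close>

lemma graphically_lipschitzian_graph:
  assumes "open U" "C-lipschitz_on U f"
  shows "graphically_lipschitzian (single_valued U f) z0 (\<lambda>z. z) UNIV U f"
proof -
  have inv: "the_inv_into UNIV (\<lambda>z::(real^'a) \<times> (real^'a). z) = (\<lambda>z. z)"
    by (rule ext) (simp add: the_inv_into_f_f[of "\<lambda>z. z" UNIV, simplified])
  have "continuously_differentiable_on (\<lambda>z::(real^'a) \<times> (real^'a). z) UNIV"
    unfolding continuously_differentiable_on_def
    by (intro exI[of _ "\<lambda>_. id_blinfun"]) (simp add: id_blinfun.rep_eq id_def)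
  then show ?thesis using assms by (auto simp: graphically_lipschitzian_def inv)
qed

lemma SCD_fun_eq:
  fixes f :: "real^'n \<Rightarrow> real^'n"
  assumes U: "open U" "u \<in> U" and lip: "C-lipschitz_on U f"
  shows "SCD_fun U f u = {range (stack_id B) |B. B \<in> B_subdiff U f u}"
proof -
  have "(u, f u) \<in> gph (single_valued U f)" using U(2) by (auto simp: graph_as_image)
  from SCD_graphically_lipschitzian[OF graphically_lipschitzian_graph[OF U(1) lip] this UNIV_I]
  show ?thesis
    using frechet_derivative_at[OF has_derivative_ident, of "(u, f u)"]
    by (simp add: SCD_fun_def inv_equality[of id id] id_def comp_def)
qed

section \<open>The SCD property and the formulas for both derivatives\<close>

theorem proposition3p17:
  fixes F :: "real^'n \<Rightarrow> (real^'n) set"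
    and xbar ybar :: "real^'n"
    and \<Phi> :: "(real^'n) \<times> (real^'n) \<Rightarrow> (real^'n) \<times> (real^'n)"
    and W :: "((real^'n) \<times> (real^'n)) set"
    and U :: "(real^'n) set"
    and f :: "real^'n \<Rightarrow> real^'n"
  assumes "(xbar, ybar) \<in> gph F"
    and "locally_closed_around (gph F) (xbar, ybar)"
    and "graphically_lipschitzian F (xbar, ybar) \<Phi> W U f"
  shows "SCD_property_around F (xbar, ybar) \<and>
    (\<forall>\<^sub>F z in nhds (xbar, ybar). z \<in> gph F \<longrightarrow>
      (let u = fst (\<Phi> z);
           D = frechet_derivative \<Phi> (at z);
           M = S_mat \<circ> adjoint D \<circ> adjoint S_mat
       in
         SCD F z = (\<lambda>L. inv D ` L) ` SCD_fun U f u \<and>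
         (\<lambda>L. inv D ` L) ` SCD_fun U f u = {range (inv D \<circ> stack_id B) |B. B \<in> B_subdiff U f u} \<and>
         SCD_adj F z = (\<lambda>L. M ` L) ` SCD_adj_fun U f u \<and>
         (\<lambda>L. M ` L) ` SCD_adj_fun U f u =
           {range (M \<circ> stack_id (transpose B)) |B. B \<in> B_subdiff U f u}))"
proof -
  note G = assms(3)
  have W: "open W" "(xbar, ybar) \<in> W" and inj: "inj_on \<Phi> W" and im: "open (\<Phi> ` W)" and U: "open U"
    and graph: "\<Phi> ` (gph F \<inter> W) = gph (single_valued U f)"
    and C1: "continuously_differentiable_on \<Phi> W" "continuously_differentiable_on (the_inv_into W \<Phi>) (\<Phi> ` W)"
    using G unfolding graphically_lipschitzian_def by blast+
  obtain C where lip: "C-lipschitz_on U f" using G unfolding graphically_lipschitzian_def by blast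
  \<comment> \<open>The set \<open>W\<close> itself serves as the neighborhood for both
    claims.\<close>
  have near: "\<forall>\<^sub>F z in nhds (xbar, ybar). z \<in> W" using W by (rule eventually_nhds_in_open)
  have u: "fst (\<Phi> z) \<in> U" if "z \<in> gph F" "z \<in> W" for z
  proof -
    have "\<Phi> z \<in> gph (single_valued U f)" using that graph by blast
    then show ?thesis by (auto simp: graph_as_image)
  qed
  \<comment> \<open>The adjoint derivative is an image of \<open>SCD F z\<close>, which is indexed
    by the nonempty B-subdifferential.\<close>
  have nonempty: "SCD_adj F z \<noteq> {}" if "z \<in> gph F" "z \<in> W" for z
    unfolding SCD_adj_eq SCD_graphically_lipschitzian[OF G that]
    using B_subdiff_nonempty[OF U u[OF that] lip] by blast
  have around: "SCD_property_around F (xbar, ybar)"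
    unfolding SCD_property_around_def by (intro eventually_mono[OF near] impI nonempty)
  have main: "SCD F z = (\<lambda>L. inv D ` L) ` SCD_fun U f u \<and>
      (\<lambda>L. inv D ` L) ` SCD_fun U f u = {range (inv D \<circ> stack_id B) |B. B \<in> B_subdiff U f u} \<and>
      SCD_adj F z = (\<lambda>L. M ` L) ` SCD_adj_fun U f u \<and>
      (\<lambda>L. M ` L) ` SCD_adj_fun U f u = {range (M \<circ> stack_id (transpose B)) |B. B \<in> B_subdiff U f u}"
    if z: "z \<in> gph F" "z \<in> W" and u_def: "u = fst (\<Phi> z)" and D_def: "D = frechet_derivative \<Phi> (at z)"
      and M_def: "M = S_mat \<circ> adjoint D \<circ> adjoint S_mat" for z u D M
  proof -
    have 1: "SCD F z = {range (inv D \<circ> stack_id B) |B. B \<in> B_subdiff U f u}"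
      unfolding u_def D_def by (rule SCD_graphically_lipschitzian[OF G z])
    have uU: "u \<in> U" unfolding u_def by (rule u[OF z])
    have 2: "SCD_fun U f u = {range (stack_id B) |B. B \<in> B_subdiff U f u}"
      by (rule SCD_fun_eq[OF U uU lip])
    have 3: "(\<lambda>L. inv D ` L) ` SCD_fun U f u = {range (inv D \<circ> stack_id B) |B. B \<in> B_subdiff U f u}"
      by (simp add: 2 Setcompr_eq_image image_image comp_def)
    have "\<exists>T. linear D \<and> linear T \<and> (\<forall>x. D (T x) = x) \<and> (\<forall>x. T (D x) = x)"
    proof (rule transformation_derivative[OF W(1) inj im C1])
      fix T assume T: "\<And>z. z \<in> W \<Longrightarrow> (\<Phi> has_derivative frechet_derivative \<Phi> (at z)) (at z)"
        "\<And>z. z \<in> W \<Longrightarrow> (the_inv_into W \<Phi> has_derivative blinfun_apply (T z)) (at (\<Phi> z))"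
        "\<And>z x. z \<in> W \<Longrightarrow> frechet_derivative \<Phi> (at z) (T z x) = x"
        "\<And>z x. z \<in> W \<Longrightarrow> T z (frechet_derivative \<Phi> (at z) x) = x"
      show ?thesis
        using has_derivative_linear[OF T(1)[OF z(2)]] has_derivative_linear[OF T(2)[OF z(2)]] T(3,4)[OF z(2)]
        unfolding D_def by (intro exI[of _ "blinfun_apply (T z)"]) simp
    qed
    then obtain T where DT: "linear D" "linear T" "\<And>x. D (T x) = x" "\<And>x. T (D x) = x" by blast
    have invD: "inv D = T" using DT(3,4) by (simp add: inv_equality)
    have adj: "adj_subspace (inv D ` L) = M ` adj_subspace L" for L
      unfolding M_def invD by (rule adj_subspace_inverse_image[OF DT])
    have 4: "SCD_adj_fun U f u = {range (stack_id (transpose B)) |B. B \<in> B_subdiff U f u}"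
      unfolding SCD_adj_fun_def SCD_adj_eq SCD_fun_def[symmetric] 2
      by (simp add: Setcompr_eq_image image_image adj_subspace_stack_id)
    have 5: "(\<lambda>L. M ` L) ` SCD_adj_fun U f u = {range (M \<circ> stack_id (transpose B)) |B. B \<in> B_subdiff U f u}"
      by (simp add: 4 Setcompr_eq_image image_image comp_def)
    \<comment> \<open>The adjoint formula follows from the primal one by taking adjoint subspaces;
      \<open>adj\<close> exchanges the inverse derivative for \<open>M\<close>.\<close>
    have "SCD_adj F z = adj_subspace ` ((\<lambda>L. inv D ` L) ` SCD_fun U f u)" unfolding SCD_adj_eq 1 3 ..
    also have "\<dots> = (\<lambda>L. M ` L) ` SCD_adj_fun U f u"
      unfolding SCD_adj_fun_def SCD_adj_eq SCD_fun_def[symmetric] image_image adj ..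
    finally show ?thesis using 1 3 5 by (simp only: simp_thms)
  qed
  show ?thesis
    by (rule conjI[OF around eventually_mono[OF near]], unfold Let_def, rule impI,
        rule main[OF _ _ refl refl refl])
qed

end
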